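(* Let $\lambda_1\in\mathbb{C}\setminus\{0\}$ and let $\Lambda=[\lambda_1,e^{2\pi i/3}\lambda_1]$ be a triangular lattice such that every critical value of the Weierstrass function $\wp_\Lambda$ is a pole of $\wp_\Lambda$ (i.e. lies in $\Lambda$). For $\beta\in\mathbb{C}\setminus\{0\}$ let $g_\beta=\beta\wp_\Lambda$. Then the set of escaping parameters $$\mathcal{E}=\{\beta\in\mathbb{C}\setminus\{0\}:\ \lim_{n\to\infty}g_\beta^n(c_i)=\infty,\ i=1,2,3\}$$ satisfies $\dim_H(\mathcal{E})\ge 4/3$.
   Context: A lattice $\Lambda=[\lambda_1,\lambda_2]=\{l\lambda_1+m\lambda_2: l,m\in\mathbb{Z}\}$ with $\mathrm{Im}(\lambda_1/\lambda_2)\neq0$; it is triangular if $\lambda_2=e^{2\pi i/3}\lambda_1$. The Weierstrass function is $\wp_\Lambda(z)=\frac1{z^2}+\sum_{w\in\Lambda\setminus\{0\}}\big(\frac1{(z-w)^2}-\frac1{w^2}\big)$; it is $\Lambda$-periodic with double poles exactly at $\Lambda$. Its critical points modulo $\Lambda$ are $c_1=\lambda_1/2$, $c_2=\lambda_2/2$, $c_3=(\lambda_1+\lambda_2)/2$, and its critical values are $\wp_\Lambda(c_i)$. $g_\beta^n$ denotes the $n$-th iterate; the condition $g_\beta^n(c_i)\to\infty$ includes that all iterates $g_\beta^n(c_i)$ are finite. $\dim_H$ is Hausdorff dimension. *)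

theory Defs
  imports "HOL-Analysis.Analysis"
begin

definition lattice :: "complex \<Rightarrow> complex \<Rightarrow> complex set" where
  "lattice l1 l2 = {of_int l * l1 + of_int m * l2 | l m. True}"

text \<open>Weierstrass function; the defining series converges absolutely off the lattice
  (its value at lattice points, i.e. the poles, is irrelevant and never used).\<close>
definition wp :: "complex set \<Rightarrow> complex \<Rightarrow> complex" where
  "wp L z = 1 / z^2 + (\<Sum>\<^sub>\<infinity> w \<in> L - {0}. 1 / (z - w)^2 - 1 / w^2)"

fun orbit :: "complex set \<Rightarrow> complex \<Rightarrow> complex \<Rightarrow> nat \<Rightarrow> complex" where
  "orbit L beta c 0 = c"
| "orbit L beta c (Suc n) = beta * wp L (orbit L beta c n)"

text \<open>g_beta^n(c) \<rightarrow> \<infinity>, including that all iterates are finite, i.e. no iterate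
  hits a pole (a lattice point).\<close>
definition escapes :: "complex set \<Rightarrow> complex \<Rightarrow> complex \<Rightarrow> bool" where
  "escapes L beta c \<longleftrightarrow> (\<forall>n. orbit L beta c n \<notin> L) \<and>
      filterlim (orbit L beta c) at_infinity sequentially"

definition hausdorff_pre :: "real \<Rightarrow> real \<Rightarrow> 'a::metric_space set \<Rightarrow> ennreal" where
  "hausdorff_pre s \<delta> A = (INF U \<in> {U :: nat \<Rightarrow> 'a set. A \<subseteq> (\<Union>i. U i) \<and>
        (\<forall>i. bounded (U i) \<and> diameter (U i) \<le> \<delta>)}.
        (\<Sum>i. ennreal (diameter (U i) powr s)))"

definition hausdorff_measure :: "real \<Rightarrow> 'a::metric_space set \<Rightarrow> ennreal" where
  "hausdorff_measure s A = (SUP \<delta> \<in> {0<..}. hausdorff_pre s \<delta> A)"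

definition hausdorff_dim :: "'a::metric_space set \<Rightarrow> real" where
  "hausdorff_dim A = Inf {s. 0 \<le> s \<and> hausdorff_measure s A = 0}"

end

(* The rotational symmetry wp (om z) = om wp z reduces the three critical orbits to that of c = l/2, whose
   first image is beta * e with e = wp c; averaging the series over the rotations shows e <> 0.
   Let h be an inverse branch of beta |-> g_beta^(n+1)(c) over a small disc around a lattice point v.
   On a disc of radius of order R^(-1/2) at distance R^(-1/2) from v, w |-> h w * wp w is a small Lipschitz
   perturbation of a linear map with factor of order R^(3/2) whose image has size of order R,
   and so contains of the order of R^2 discs around lattice points; over each of them there is a new inverse branch.
   Thus a piece of size d has R^2 children of size d R^(-3/2), and if R grows slowly along the levels,
   every exponent below 4/3 is a lower bound for the dimension of the limit set.
   Bi-Lipschitz estimates for inverse branches replace distortion theorems, and no holomorphy is used. *)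
theory Submission
  imports Defs
begin

section \<open>Covers of Cantor sets with a grid structure\<close>

text \<open>The exponent 4/3 is where \<open>R^2\<close> children of relative size
  \<open>R^(-3/2)\<close> balance: \<open>R^2 * (R^(-3/2))^t = 1\<close>. For smaller
  \<open>t\<close> each level leaves a surplus that is a power of \<open>R\<close>; as
  \<open>R\<close> tends to infinity along the levels, it absorbs any fixed factor lost per level.
  Hence crude constants such as \<open>3/4\<close> and \<open>5/4\<close> suffice, and no distortion
  constant has to tend to 1. The obstacle is that the children do not fill their parent but crowd
  over a disc of radius of order \<open>R^(-1/2)\<close> in it. A covering set can therefore catch
  all children of a piece while being much smaller than the piece. This loss concerns only the level
  at which the covering set lives and does not accumulate; because \<open>R\<close> is
  \<open>K + n\<close>, neighbouring levels are comparable and the surplus pays for it. Moreover the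
  parameter and the orbit point move together, so that the next iterate is the product
  \<open>h w * wp L w\<close>. Near a pole the variation of the second factor dominates, and for
  this it is enough that \<open>h\<close> keeps one and the same upper Lipschitz constant on all
  levels.\<close>

lemma card_nat_le_diff:
  fixes A :: "nat set"
  assumes "finite A" "\<And>a b. a \<in> A \<Longrightarrow> b \<in> A \<Longrightarrow> \<bar>real a - real b\<bar> \<le> q" "0 \<le> q"
  shows "real (card A) \<le> q + 1"
proof (cases "A = {}")
  case False
  have "A \<subseteq> {Min A..Max A}" using assms(1) by auto
  then have "card A \<le> card {Min A..Max A}" by (intro card_mono) auto
  then have "real (card A) \<le> real (Suc (Max A) - Min A)" by simp
  moreover have "Min A \<le> Max A" using False assms(1) by (simp add: Max.coboundedI)
  moreover have "\<bar>real (Max A) - real (Min A)\<bar> \<le> q"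
    using assms False by (intro assms(2)) auto
  ultimately show ?thesis by (simp add: of_nat_diff)
qed (use assms in auto)

text \<open>Bounds the proportion of the descendants of a piece of mass \<open>\<mu>\<close> that a set of diameter \<open>r\<close> can meet.\<close>
definition cell_weight :: "real \<Rightarrow> real \<Rightarrow> real \<Rightarrow> real \<Rightarrow> real" where
  "cell_weight C t \<mu> r = min 1 (C * r powr t / \<mu>)"

text \<open>The averaging step: over the \<open>N^2\<close> children, the mean weight of
  \<open>U\<close> does not exceed its weight at the parent. For \<open>r < s / 2\<close> the
  separation bound is below 1, so at most one child is met; its weight may be \<open>N^2\<close>
  times larger, which the right-hand side allows. For larger \<open>r\<close> each grid coordinate
  varies by at most \<open>2 * r / s\<close>. The hypothesis \<open>cond\<close> says that a set as
  wide as a quarter of the grid already has full weight at the parent.\<close>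

lemma grid_children_weight:
  fixes ch :: "nat \<times> nat \<Rightarrow> 'a::metric_space set" and N :: nat and s :: real
  assumes sep: "\<And>p q x y. \<lbrakk>p \<in> {..<N} \<times> {..<N}; q \<in> {..<N} \<times> {..<N}; x \<in> ch p; y \<in> ch q\<rbrakk> \<Longrightarrow>
      \<bar>real (fst p) - real (fst q)\<bar> \<le> 1/2 + dist x y / s \<and>
      \<bar>real (snd p) - real (snd q)\<bar> \<le> 1/2 + dist x y / s"
    and N: "1 \<le> N" and s: "0 < s" and \<mu>: "0 < \<mu>" and C: "0 < C" and t: "t \<le> 2" "0 < t"
    and cond: "\<mu> \<le> C * (N * s / 4) powr t"
    and U: "bounded U" "diameter U \<le> r" "0 < r"
  shows "real (card {p \<in> {..<N} \<times> {..<N}. ch p \<inter> U \<noteq> {}}) * cell_weight C t (\<mu> / (real N)^2) r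
    \<le> (real N)^2 * cell_weight C t \<mu> r"
proof -
  let ?T = "{p \<in> {..<N} \<times> {..<N}. ch p \<inter> U \<noteq> {}}"
  have finT: "finite ?T" by (rule finite_subset[of _ "{..<N} \<times> {..<N}"]) auto
  have N2: "1 \<le> (real N)^2" using N by simp
  have dist_r: "dist x y \<le> r" if "x \<in> U" "y \<in> U" for x y
    using diameter_bounded_bound[OF U(1) that] U(2) by linarith
  have nn: "0 \<le> cell_weight C t \<mu>' r" if "0 < \<mu>'" for \<mu>'
    using that C by (simp add: cell_weight_def)
  have sepT: "\<bar>real (fst p) - real (fst q)\<bar> \<le> 1/2 + r / s \<and> \<bar>real (snd p) - real (snd q)\<bar> \<le> 1/2 + r / s"
    if pq: "p \<in> ?T" "q \<in> ?T" for p q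
  proof -
    obtain x y where x: "x \<in> ch p" "x \<in> U" and y: "y \<in> ch q" "y \<in> U" using pq by blast
    have "dist x y / s \<le> r / s" using dist_r[OF x(2) y(2)] s by (simp add: divide_right_mono)
    then show ?thesis using sep[of p q x y] pq x y by force
  qed
  show ?thesis
  proof (cases "r < s / 2")
    case True
    have "r / s < 1/2" using True s by (simp add: field_simps)
    have "p = q" if "p \<in> ?T" "q \<in> ?T" for p q
    proof -
      have "\<bar>real (fst p) - real (fst q)\<bar> < 1" "\<bar>real (snd p) - real (snd q)\<bar> < 1"
        using sepT[OF that] \<open>r / s < 1/2\<close> by linarith+
      then have "fst p = fst q" "snd p = snd q" by linarith+
      then show ?thesis by (simp add: prod_eq_iff)
    qed
    then have "card ?T \<le> 1" using finT by (metis (no_types, lifting) card_le_Suc0_iff_eq One_nat_def)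
    then have "real (card ?T) * cell_weight C t (\<mu> / (real N)^2) r \<le> 1 * cell_weight C t (\<mu> / (real N)^2) r"
      using nn[of "\<mu> / (real N)^2"] N \<mu> by (intro mult_right_mono) auto
    also have "\<dots> = min 1 ((real N)^2 * (C * r powr t / \<mu>))"
      by (simp add: cell_weight_def field_simps)
    also have "\<dots> \<le> (real N)^2 * cell_weight C t \<mu> r"
      unfolding cell_weight_def using N2 by (auto simp: min_def)
    finally show ?thesis .
  next
    case False
    let ?q = "2 * r / s"
    have rs: "1/2 \<le> r / s" using False s by (simp add: field_simps)
    have "real (card (fst ` ?T)) \<le> ?q + 1"
    proof (rule card_nat_le_diff)
      fix a b assume "a \<in> fst ` ?T" "b \<in> fst ` ?T"
      then obtain p q where "p \<in> ?T" "q \<in> ?T" "a = fst p" "b = fst q" by blast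
      then show "\<bar>real a - real b\<bar> \<le> ?q" using sepT[of p q] rs by simp
    qed (use finT s U in auto)
    moreover have "real (card (snd ` ?T)) \<le> ?q + 1"
    proof (rule card_nat_le_diff)
      fix a b assume "a \<in> snd ` ?T" "b \<in> snd ` ?T"
      then obtain p q where "p \<in> ?T" "q \<in> ?T" "a = snd p" "b = snd q" by blast
      then show "\<bar>real a - real b\<bar> \<le> ?q" using sepT[of p q] rs by simp
    qed (use finT s U in auto)
    moreover have "?q + 1 \<le> 4 * r / s" using rs by simp
    ultimately have c: "real (card (fst ` ?T)) \<le> 4*r/s" "real (card (snd ` ?T)) \<le> 4*r/s"
      by linarith+
    have "card ?T \<le> card (fst ` ?T \<times> snd ` ?T)"
      using finT by (intro card_mono subset_fst_snd finite_cartesian_product finite_imageI)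
    then have "real (card ?T) \<le> real (card (fst ` ?T)) * real (card (snd ` ?T))"
      unfolding card_cartesian_product of_nat_mult[symmetric] by (rule of_nat_mono)
    also have "\<dots> \<le> (4*r/s) * (4*r/s)" using c by (intro mult_mono) auto
    finally have c1: "real (card ?T) \<le> (4*r/s)^2" by (simp add: power2_eq_square)
    have "card ?T \<le> card ({..<N} \<times> {..<N})" by (intro card_mono) auto
    then have c2: "real (card ?T) \<le> (real N)^2"
      by (simp add: power2_eq_square flip: of_nat_mult)
    \<comment> \<open>The size \<open>r\<close> in units of a quarter of the side
      \<open>N * s\<close> of the grid. In this unit the two counts are \<open>N^2 * x^2\<close> and
      \<open>N^2\<close>, and \<open>cond\<close> bounds \<open>x powr t\<close> by the weight at
      the parent.\<close>
    define x where "x = 4 * r / (s * N)"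
    have x0: "0 < x" using U s N by (simp add: x_def)
    have c1': "real (card ?T) \<le> (real N)^2 * x^2"
      using c1 N by (simp add: x_def power2_eq_square)
    \<comment> \<open>interpolates between the bounds \<open>c1'\<close> and \<open>c2\<close>\<close>
    have "real (card ?T) \<le> (real N)^2 * min 1 (x powr t)"
    proof (cases "x \<le> 1")
      case True
      have "x^2 = x powr 2" using x0 by (simp add: powr_numeral)
      also have "\<dots> \<le> x powr t" using True x0 t by (intro powr_mono') auto
      finally have "x^2 \<le> min 1 (x powr t)" using True t x0 by (simp add: powr_le1)
      then show ?thesis using c1' by (meson mult_left_mono order_trans zero_le_power2)
    next
      case False
      then have "min 1 (x powr t) = 1" using t by (simp add: ge_one_powr_ge_zero)
      then show ?thesis using c2 by simp
    qed
    also have "x powr t \<le> C * r powr t / \<mu>"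
    proof -
      have xe: "x = r / (N * s / 4)" by (simp add: x_def field_simps)
      have "x powr t = r powr t / (N * s / 4) powr t"
        unfolding xe by (rule powr_divide)
      also have "\<dots> \<le> C * r powr t / \<mu>"
      proof -
        have "r powr t * \<mu> \<le> r powr t * (C * (N * s / 4) powr t)"
          by (rule mult_left_mono[OF cond]) simp
        moreover have "0 < (N * s / 4) powr t" using s N by simp
        ultimately show ?thesis using \<mu> by (simp add: field_simps)
      qed
      finally show ?thesis .
    qed
    finally have c3: "real (card ?T) \<le> (real N)^2 * cell_weight C t \<mu> r"
      by (auto simp: cell_weight_def mult_left_mono min_le_iff_disj)
    have "real (card ?T) * cell_weight C t (\<mu> / (real N)^2) r \<le> real (card ?T) * 1"
      by (intro mult_left_mono) (auto simp: cell_weight_def)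
    then show ?thesis using c3 by linarith
  qed
qed

lemma exists_le_average:
  fixes f :: "'a \<Rightarrow> real"
  assumes "finite A" "sum f A < real (card A) * c"
  shows "\<exists>a\<in>A. f a < c"
proof (rule ccontr)
  assume "\<not> ?thesis"
  then have "real (card A) * c \<le> sum f A" by (intro sum_bounded_below) (auto simp: not_less)
  then show False using assms by simp
qed

text \<open>No measure is constructed: if the cover is too cheap, averaging over the children always finds a
  child such that the weights of the covering sets that meet it add up to less than 1, and the limit
  point of the resulting branch is not covered, since the weight of a set of positive radius that meets
  every piece of the branch reaches 1.\<close>
theorem cantor_scheme_cover_bound:
  fixes P :: "nat \<Rightarrow> 'a::heine_borel set \<Rightarrow> bool" and N :: "nat \<Rightarrow> nat" and s :: "nat \<Rightarrow> real"
    and U :: "nat \<Rightarrow> 'a set"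
  defines "\<mu> \<equiv> \<lambda>n. \<Prod>i<n. 1 / (real (N i))^2"
  assumes root: "P 0 S0"
    and comp: "\<And>n S. P n S \<Longrightarrow> compact S \<and> S \<noteq> {}"
    and step: "\<And>n S. P n S \<Longrightarrow> \<exists>ch. \<forall>p \<in> {..<N n} \<times> {..<N n}. P (Suc n) (ch p) \<and> ch p \<subseteq> S \<and>
        (\<forall>q \<in> {..<N n} \<times> {..<N n}. \<forall>x \<in> ch p. \<forall>y \<in> ch q.
          \<bar>real (fst p) - real (fst q)\<bar> \<le> 1/2 + dist x y / s n \<and>
          \<bar>real (snd p) - real (snd q)\<bar> \<le> 1/2 + dist x y / s n)"
    and limit: "\<And>S x. (\<And>n. P n (S n)) \<Longrightarrow> (\<And>n. x \<in> S n) \<Longrightarrow> x \<in> E"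
    and N: "\<And>n. 2 \<le> N n" and s: "\<And>n. 0 < s n" and C: "0 < C" and t: "0 < t" "t \<le> 2"
    and cond: "\<And>n. \<mu> n \<le> C * (N n * s n / 4) powr t"
    and cover: "E \<subseteq> (\<Union>i. U i)"
    and U: "\<And>i. bounded (U i)" "\<And>i. diameter (U i) \<le> r i" "\<And>i. 0 < r i"
    and sum: "summable (\<lambda>i. r i powr t)"
  shows "1 \<le> C * (\<Sum>i. r i powr t)"
proof (rule ccontr)
  assume contr: "\<not> ?thesis"
  have N0: "0 < N n" for n using N[of n] by simp
  have \<mu>0: "0 < \<mu> n" for n unfolding \<mu>_def using N0 by (intro prod_pos) simp
  have \<mu>S: "\<mu> (Suc n) = \<mu> n / (real (N n))^2" for n unfolding \<mu>_def by simp
  define w where "w n i = cell_weight C t (\<mu> n) (r i)" for n i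
  define W where "W n S i = (if S \<inter> U i = {} then 0 else w n i)" for n S i
  have w0: "0 \<le> w n i" for n i using C \<mu>0[of n] by (simp add: w_def cell_weight_def)
  have w_le: "w n i \<le> C / \<mu> n * r i powr t" for n i by (simp add: w_def cell_weight_def)
  have W0: "0 \<le> W n S i" and W_le: "W n S i \<le> C / \<mu> n * r i powr t" for n S i
    using w0[of n i] w_le[of n i] by (auto simp: W_def)
  have sumW: "summable (W n S)" for n S
    by (rule summable_comparison_test'[OF summable_mult[OF sum, of "C / \<mu> n"], of 0])
       (use W0 W_le in simp)
  define Q where "Q n S \<longleftrightarrow> P n S \<and> suminf (W n S) < 1" for n S
  have Q0: "Q 0 S0"
  proof -
    have "suminf (W 0 S0) \<le> (\<Sum>i. C / \<mu> 0 * r i powr t)"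
      by (intro suminf_le sumW summable_mult sum W_le)
    also have "\<dots> = C * (\<Sum>i. r i powr t)"
      using suminf_mult[OF sum, of "C"] by (simp add: \<mu>_def)
    finally show ?thesis using contr root by (simp add: Q_def)
  qed
  have Qstep: "\<exists>S'. Q (Suc n) S' \<and> S' \<subseteq> S" if QS: "Q n S" for n S
  proof -
    let ?G = "{..<N n} \<times> {..<N n}"
    have "P n S" using QS by (simp add: Q_def)
    from step[OF this] obtain ch where all: "\<forall>p \<in> ?G. P (Suc n) (ch p) \<and> ch p \<subseteq> S \<and>
        (\<forall>q \<in> ?G. \<forall>x \<in> ch p. \<forall>y \<in> ch q.
          \<bar>real (fst p) - real (fst q)\<bar> \<le> 1/2 + dist x y / s n \<and>
          \<bar>real (snd p) - real (snd q)\<bar> \<le> 1/2 + dist x y / s n)" ..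
    have ch: "P (Suc n) (ch p)" "ch p \<subseteq> S" if "p \<in> ?G" for p
      using bspec[OF all that] by blast+
    have sep: "\<bar>real (fst p) - real (fst q)\<bar> \<le> 1/2 + dist x y / s n \<and>
          \<bar>real (snd p) - real (snd q)\<bar> \<le> 1/2 + dist x y / s n"
      if "p \<in> ?G" "q \<in> ?G" "x \<in> ch p" "y \<in> ch q" for p q x y
      using bspec[OF all that(1)] that(2-) by blast
    have main: "(\<Sum>p\<in>?G. W (Suc n) (ch p) i) \<le> (real (N n))^2 * W n S i" for i
    proof (cases "S \<inter> U i = {}")
      case True
      then have "W (Suc n) (ch p) i = 0" if "p \<in> ?G" for p using ch(2)[OF that] by (auto simp: W_def)
      then show ?thesis using W0 by simp
    next
      case False
      have "(\<Sum>p\<in>?G. W (Suc n) (ch p) i) = (\<Sum>p\<in>{p\<in>?G. ch p \<inter> U i \<noteq> {}}. w (Suc n) i)"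
        unfolding W_def by (rule sum.mono_neutral_cong_right) auto
      also have "\<dots> = real (card {p\<in>?G. ch p \<inter> U i \<noteq> {}}) * w (Suc n) i" by simp
      also have "\<dots> \<le> (real (N n))^2 * w n i"
        unfolding w_def \<mu>S
        by (rule grid_children_weight[where s = "s n"])
           (use sep N0[of n] s \<mu>0 C t cond U in auto)
      finally show ?thesis using False by (simp add: W_def)
    qed
    have "(\<Sum>p\<in>?G. suminf (W (Suc n) (ch p))) = (\<Sum>i. \<Sum>p\<in>?G. W (Suc n) (ch p) i)"
      by (rule suminf_sum[symmetric]) (rule sumW)
    also have "\<dots> \<le> (\<Sum>i. (real (N n))^2 * W n S i)"
      by (intro suminf_le main summable_sum summable_mult sumW)
    also have "\<dots> = (real (N n))^2 * suminf (W n S)" by (rule suminf_mult[OF sumW])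
    also have "\<dots> < (real (N n))^2 * 1"
      using QS N0[of n] unfolding Q_def by (intro mult_strict_left_mono) auto
    finally have "(\<Sum>p\<in>?G. suminf (W (Suc n) (ch p))) < real (card ?G) * 1"
      by (simp add: power2_eq_square)
    from exists_le_average[OF _ this] obtain p where "p \<in> ?G" "suminf (W (Suc n) (ch p)) < 1" by auto
    then show ?thesis using ch(1,2)[of p] unfolding Q_def by blast
  qed
  obtain S where S: "\<And>n. Q n (S n)" "\<And>n. S (Suc n) \<subseteq> S n"
    using dependent_nat_choice[of Q "\<lambda>n S S'. S' \<subseteq> S"] Q0 Qstep by metis
  have PS: "P n (S n)" for n using S(1) by (simp add: Q_def)
  have "(\<Inter>n. S n) \<noteq> {}"
  proof (rule compact_nest)
    show "compact (S n)" "S n \<noteq> {}" for n using comp[OF PS] by auto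
    show "S n \<subseteq> S m" if "m \<le> n" for m n using lift_Suc_antimono_le[of S] S(2) that by blast
  qed
  then obtain x where x: "\<And>n. x \<in> S n" by blast
  then have "x \<in> E" using limit PS by blast
  then obtain i where i: "x \<in> U i" using cover by blast
  have "C * r i powr t < \<mu> n" for n
  proof -
    have "W n (S n) i = w n i" using x[of n] i by (auto simp: W_def)
    moreover have "W n (S n) i \<le> suminf (W n (S n))"
      using sum_le_suminf[OF sumW, of "{i}"] W0 by simp
    ultimately have "w n i < 1" using S(1)[of n] by (simp add: Q_def)
    then show ?thesis using \<mu>0[of n] by (simp add: w_def cell_weight_def min_def field_simps split: if_splits)
  qed
  \<comment> \<open>Since \<open>N i\<close> is at least 2, the masses tend to 0, whereas
    \<open>C * r i powr t\<close> is a fixed positive number.\<close>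
  moreover have "\<mu> n \<le> (1/4)^n" for n
  proof -
    have "\<mu> n \<le> (\<Prod>i<n. 1/4)" unfolding \<mu>_def
    proof (rule prod_mono, safe)
      fix i
      have "(2::real)^2 \<le> (real (N i))^2" using N[of i] by (intro power_mono) auto
      then show "1 / (real (N i))^2 \<le> 1/4" by (intro frac_le) auto
    qed auto
    then show ?thesis by simp
  qed
  ultimately have "C * r i powr t < (1/4)^n" for n by (meson less_le_trans)
  moreover have "0 < C * r i powr t" using C U(3)[of i] by simp
  then obtain n where "(1/4::real)^n < C * r i powr t" using real_arch_pow_inv[of "C * r i powr t" "1/4"] by auto
  ultimately show False by (meson less_asym)
qed

text \<open>Since \<open>0 powr t = 0\<close>, singletons are free in \<open>hausdorff_pre\<close>; the radii \<open>r i\<close> are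
  enlarged diameters, so that they are positive.\<close>
lemma hausdorff_measure_zero_cover:
  fixes A :: "'a::metric_space set"
  assumes zero: "hausdorff_measure s A = 0" and st: "0 \<le> s" "s \<le> t" "0 < t" and \<eta>: "0 < \<eta>"
  obtains U r where "A \<subseteq> (\<Union>i::nat. U i)" "\<And>i. bounded (U i)" "\<And>i. diameter (U i) \<le> r i"
    "\<And>i. 0 < r i" "summable (\<lambda>i. r i powr t)" "(\<Sum>i. r i powr t) \<le> \<eta>"
proof -
  \<comment> \<open>At scale 1 all diameters are at most 1, so raising the exponent from
    \<open>s\<close> to \<open>t\<close> does not increase the sum.\<close>
  have "hausdorff_pre s 1 A \<le> hausdorff_measure s A"
    unfolding hausdorff_measure_def by (rule SUP_upper) simp
  then have "hausdorff_pre s 1 A < ennreal (\<eta>/2)" using zero \<eta> by (simp add: ennreal_less_zero_iff)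
  then obtain U where U: "A \<subseteq> (\<Union>i. U i)" "\<And>i. bounded (U i)" "\<And>i. diameter (U i) \<le> 1"
    and lt: "(\<Sum>i. ennreal (diameter (U i) powr s)) < ennreal (\<eta>/2)"
    unfolding hausdorff_pre_def INF_less_iff by auto
  have d0: "0 \<le> diameter (U i)" for i using U(2) by (rule diameter_ge_0)
  have "(\<Sum>i. ennreal (diameter (U i) powr t)) \<le> (\<Sum>i. ennreal (diameter (U i) powr s))"
    by (intro suminf_le ennreal_leI powr_mono') (use st U d0 in auto)
  with lt have lt': "(\<Sum>i. ennreal (diameter (U i) powr t)) < ennreal (\<eta>/2)" by (rule le_less_trans[rotated])
  have sm: "summable (\<lambda>i. diameter (U i) powr t)"
    by (rule summable_suminf_not_top) (use lt' in auto)
  then have "ennreal (\<Sum>i. diameter (U i) powr t) < ennreal (\<eta>/2)"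
    using lt' by (subst suminf_ennreal2[symmetric]) auto
  then have lt2: "(\<Sum>i. diameter (U i) powr t) < \<eta>/2"
    using \<eta> by (simp add: ennreal_less_iff suminf_nonneg sm)
  \<comment> \<open>A positive surcharge of total \<open>\<eta>/2\<close>; added to the powers of
    the diameters, it makes all radii positive at the price of half the budget.\<close>
  define e where "e i = \<eta>/2 * (1/2)^Suc i" for i :: nat
  have e0: "0 < e i" for i using \<eta> by (simp add: e_def)
  have e_sums: "e sums (\<eta>/2)"
    using sums_mult[OF power_half_series, of "\<eta>/2"] by (simp add: e_def[abs_def])
  define r where "r i = (diameter (U i) powr t + e i) powr (1/t)" for i
  have rt: "r i powr t = diameter (U i) powr t + e i" for i
    using st e0[of i] by (simp add: r_def powr_powr add_nonneg_nonneg less_imp_le)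
  show ?thesis
  proof
    show "A \<subseteq> (\<Union>i. U i)" "\<And>i. bounded (U i)" by fact+
    show "0 < r i" for i
    proof -
      have "0 < diameter (U i) powr t + e i" using e0[of i] by (intro add_nonneg_pos) auto
      then show ?thesis unfolding r_def by simp
    qed
    show "diameter (U i) \<le> r i" for i
    proof -
      have "diameter (U i) = (diameter (U i) powr t) powr (1/t)"
        using st d0[of i] by (simp add: powr_powr)
      also have "\<dots> \<le> r i" unfolding r_def using st e0[of i] by (intro powr_mono2) auto
      finally show ?thesis .
    qed
    show "summable (\<lambda>i. r i powr t)"
      unfolding rt using sm e_sums by (intro summable_add) (auto simp: sums_iff)
    have "(\<Sum>i. r i powr t) = (\<Sum>i. diameter (U i) powr t) + \<eta>/2"
      unfolding rt using suminf_add[OF sm, of e] e_sums by (simp add: sums_iff)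
    then show "(\<Sum>i. r i powr t) \<le> \<eta>" using lt2 by simp
  qed
qed

section \<open>Null covers of the plane and lower bounds for the Hausdorff dimension\<close>

text \<open>Cutting the square into \<open>n * n\<close> cells of side of order \<open>1/n\<close>
  costs \<open>O(1/n)\<close> in the exponent 3, because 3 exceeds the dimension of the
  plane.\<close>

lemma square_cover:
  fixes R \<eta> :: real
  assumes "0 < R" "0 < \<eta>" "0 < \<delta>"
  obtains V :: "nat \<Rightarrow> complex set"
  where "{z. -R \<le> Re z \<and> Re z < R \<and> -R \<le> Im z \<and> Im z < R} \<subseteq> (\<Union>j. V j)"
    "\<And>j. bounded (V j)" "\<And>j. diameter (V j) \<le> \<delta>"
    "(\<Sum>j. ennreal (diameter (V j) powr 3)) \<le> ennreal \<eta>"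
proof -
  \<comment> \<open>The first bound brings the diameter bound \<open>2 * h = 4 * R / n\<close> below
    \<open>\<delta>\<close>, the second brings the total cost \<open>64 * R^3 / n\<close> below
    \<open>\<eta>\<close>.\<close>
  obtain n :: nat where n: "max (4*R/\<delta>) (64*R^3/\<eta>) < n" using reals_Archimedean2 by blast
  then have n1: "4*R/\<delta> < n" and n2: "64*R^3/\<eta> < n" by auto
  have "0 < 4*R/\<delta>" using assms by simp
  then have n0: "0 < real n" using n1 by linarith
  define h where "h = 2*R/n"
  have h0: "0 < h" using n0 assms by (simp add: h_def)
  \<comment> \<open>Quotient and remainder of \<open>j\<close> by \<open>n\<close> are the
    coordinates of the cell. From \<open>n * n\<close> on the sets are empty, have diameter 0 and
    cost nothing.\<close>
  define V where "V j = (if j < n*n then {z::complex. real (j div n) * h \<le> Re z + R \<and> Re z + R \<le> real (j div n) * h + h \<and>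
      real (j mod n) * h \<le> Im z + R \<and> Im z + R \<le> real (j mod n) * h + h} else {})" for j
  have dV: "dist x y \<le> 2*h" if "x \<in> V j" "y \<in> V j" for x y j
  proof -
    have "\<bar>Re (x - y)\<bar> \<le> h" "\<bar>Im (x - y)\<bar> \<le> h" using that by (auto simp: V_def split: if_splits)
    then show ?thesis using cmod_le[of "x - y"] by (simp add: dist_norm)
  qed
  have bV: "bounded (V j)" for j
    unfolding bounded_two_points using dV by blast
  have diamV: "diameter (V j) \<le> 2*h" for j
    using dV h0 by (intro diameter_le) (auto simp: dist_norm)
  show ?thesis
  proof
    show "bounded (V j)" for j by (rule bV)
    have "2*h \<le> \<delta>" using n1 n0 assms by (simp add: h_def field_simps)
    then show "diameter (V j) \<le> \<delta>" for j using diamV[of j] by linarith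
    show "{z. -R \<le> Re z \<and> Re z < R \<and> -R \<le> Im z \<and> Im z < R} \<subseteq> (\<Union>j. V j)"
    proof safe
      fix z assume z: "-R \<le> Re z" "Re z < R" "-R \<le> Im z" "Im z < R"
      have ex: "\<exists>a<n. real a * h \<le> x \<and> x \<le> real a * h + h" if "0 \<le> x" "x < 2*R" for x
      proof (intro exI conjI)
        let ?a = "nat \<lfloor>x / h\<rfloor>"
        have x: "0 \<le> x / h" using that h0 by simp
        then have a: "real ?a \<le> x / h" "x / h < real ?a + 1" by linarith+
        then show "real ?a * h \<le> x" "x \<le> real ?a * h + h" using h0 by (auto simp: field_simps)
        have "x / h < n" using that h0 n0 by (simp add: h_def field_simps)
        then show "?a < n" using a by linarith
      qed
      obtain a where a: "a < n" "real a * h \<le> Re z + R" "Re z + R \<le> real a * h + h" using ex[of "Re z + R"] z by auto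
      obtain b where b: "b < n" "real b * h \<le> Im z + R" "Im z + R \<le> real b * h + h" using ex[of "Im z + R"] z by auto
      have "a * n + b < n * n"
      proof -
        have "a * n + b < Suc a * n" using b by simp
        also have "\<dots> \<le> n * n" using a by (intro mult_right_mono) auto
        finally show ?thesis .
      qed
      then have "z \<in> V (a * n + b)" using a b by (simp add: V_def)
      then show "z \<in> (\<Union>j. V j)" by blast
    qed
    have "(\<Sum>j. ennreal (diameter (V j) powr 3)) = (\<Sum>j<n*n. ennreal (diameter (V j) powr 3))"
      by (rule suminf_finite) (auto simp: V_def)
    also have "\<dots> \<le> (\<Sum>j<n*n. ennreal ((2*h) powr 3))"
      using diamV diameter_ge_0[OF bV] by (intro sum_mono ennreal_leI powr_mono2) auto
    also have "\<dots> = ennreal (real (n*n) * (2*h) powr 3)"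
      using h0 by (simp add: ennreal_of_nat_eq_real_of_nat ennreal_mult)
    also have "real (n*n) * (2*h) powr 3 = 64*R^3/n"
      using h0 n0 by (simp add: h_def powr_numeral field_simps power3_eq_cube)
    also have "ennreal (64*R^3/n) \<le> ennreal \<eta>"
      using n2 n0 assms by (intro ennreal_leI) (simp add: field_simps)
    finally show "(\<Sum>j. ennreal (diameter (V j) powr 3)) \<le> ennreal \<eta>" .
  qed
qed

text \<open>Supplies one exponent of vanishing measure, so that the infimum defining
  \<open>hausdorff_dim\<close> is taken over a nonempty set. Growing squares exhaust the plane, and
  the square of index \<open>k\<close> receives the share \<open>\<eta> / 2^(k+1)\<close> of the
  budget.\<close>

lemma hausdorff_measure_3_complex: "hausdorff_measure 3 (A :: complex set) = 0"
proof -
  have le: "hausdorff_pre 3 \<delta> A \<le> ennreal \<eta>" if "0 < \<delta>" "0 < \<eta>" for \<delta> \<eta>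
  proof -
    define Sq where "Sq k = {z::complex. -real (Suc k) \<le> Re z \<and> Re z < real (Suc k) \<and>
      -real (Suc k) \<le> Im z \<and> Im z < real (Suc k)}" for k
    define good where "good k V \<longleftrightarrow> Sq k \<subseteq> (\<Union>j. V j) \<and> (\<forall>j. bounded (V j) \<and> diameter (V j) \<le> \<delta>) \<and>
        (\<Sum>j. ennreal (diameter (V j) powr 3)) \<le> ennreal (\<eta> * (1/2)^Suc k)"
      for k and V :: "nat \<Rightarrow> complex set"
    have "\<exists>V. good k V" for k
    proof -
      have "0 < real (Suc k)" "0 < \<eta> * (1/2)^Suc k" using that by auto
      then show ?thesis using that(1) unfolding good_def Sq_def by (rule square_cover) blast
    qed
    then obtain V where V: "\<And>k. good k (V k)" by metis
    have V1: "Sq k \<subseteq> (\<Union>j. V k j)" and V2: "bounded (V k j) \<and> diameter (V k j) \<le> \<delta>"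
      and V3: "(\<Sum>j. ennreal (diameter (V k j) powr 3)) \<le> ennreal (\<eta> * (1/2)^Suc k)" for k j
      using V[of k] by (auto simp: good_def)
    define U where "U i = V (fst (prod_decode i)) (snd (prod_decode i))" for i
    have cov: "A \<subseteq> (\<Union>i. U i)"
    proof
      fix z assume "z \<in> A"
      obtain k :: nat where "max \<bar>Re z\<bar> \<bar>Im z\<bar> < k" using reals_Archimedean2 by blast
      then have "z \<in> Sq k" by (auto simp: Sq_def)
      then have "z \<in> (\<Union>j. V k j)" using V1[of k] by blast
      then obtain j where "z \<in> V k j" by blast
      then have "z \<in> U (prod_encode (k, j))" by (simp add: U_def)
      then show "z \<in> (\<Union>i. U i)" by blast
    qed
    have "hausdorff_pre 3 \<delta> A \<le> (\<Sum>i. ennreal (diameter (U i) powr 3))"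
      unfolding hausdorff_pre_def using cov V2 by (intro INF_lower) (auto simp: U_def)
    also have "\<dots> = (\<Sum>k. \<Sum>j. ennreal (diameter (V k j) powr 3))"
      unfolding U_def
      by (rule suminf_ennreal_2dimen[where f = "\<lambda>p. ennreal (diameter (V (fst p) (snd p)) powr 3)"])
        simp
    also have "\<dots> \<le> (\<Sum>k. ennreal (\<eta> * (1/2)^Suc k))"
      by (intro suminf_le V3) auto
    also have "\<dots> = ennreal \<eta>"
    proof -
      have su: "(\<lambda>k. \<eta> * (1/2)^Suc k) sums \<eta>" using sums_mult[OF power_half_series, of \<eta>] by simp
      have nn: "0 \<le> \<eta> * (1/2)^Suc k" for k using that by simp
      show ?thesis
        unfolding suminf_ennreal2[OF nn sums_summable[OF su]] sums_unique[OF su, symmetric] ..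
    qed
    finally show ?thesis .
  qed
  have "hausdorff_pre 3 \<delta> A \<le> 0" if "0 < \<delta>" for \<delta>
  proof (rule ennreal_le_epsilon)
    show "hausdorff_pre 3 \<delta> A \<le> 0 + ennreal e" if "0 < e" for e
      using le[OF \<open>0 < \<delta>\<close> that] by simp
  qed
  then have "hausdorff_measure 3 A \<le> 0"
    unfolding hausdorff_measure_def by (intro SUP_least) auto
  then show ?thesis by simp
qed

definition radius_cover :: "real \<Rightarrow> 'a::metric_space set \<Rightarrow> (nat \<Rightarrow> 'a set) \<Rightarrow> (nat \<Rightarrow> real) \<Rightarrow> bool" where
  "radius_cover t A U r \<longleftrightarrow> A \<subseteq> (\<Union>i. U i) \<and> (\<forall>i. bounded (U i)) \<and> (\<forall>i. diameter (U i) \<le> r i) \<and>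
    (\<forall>i. 0 < r i) \<and> summable (\<lambda>i. r i powr t)"

lemma hausdorff_dim_ge:
  fixes A :: "complex set" and d :: real
  assumes d: "1 < d"
    and bound: "\<And>t. 1 \<le> t \<Longrightarrow> t < d \<Longrightarrow> \<exists>C>0. \<forall>U r. radius_cover t A U r \<longrightarrow> 1 \<le> C * (\<Sum>i. r i powr t)"
  shows "d \<le> hausdorff_dim A"
  unfolding hausdorff_dim_def
proof (rule cInf_greatest)
  \<comment> \<open>otherwise the infimum would be unspecified\<close>
  show "{s. 0 \<le> s \<and> hausdorff_measure s A = 0} \<noteq> {}"
    using hausdorff_measure_3_complex[of A] by (auto intro!: exI[of _ 3])
  fix s assume "s \<in> {s. 0 \<le> s \<and> hausdorff_measure s A = 0}"
  then have s: "0 \<le> s" "hausdorff_measure s A = 0" by auto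
  show "d \<le> s"
  proof (rule ccontr)
    assume "\<not> d \<le> s"
    \<comment> \<open>The assumed bounds start at exponent 1; a measure that vanishes at a smaller
      \<open>s\<close> still yields cheap covers at this larger exponent.\<close>
    define t where "t = max s 1"
    have t: "1 \<le> t" "t < d" "s \<le> t" "0 < t" using d \<open>\<not> d \<le> s\<close> by (auto simp: t_def)
    obtain C where C: "0 < C" "\<And>U r. radius_cover t A U r \<Longrightarrow> 1 \<le> C * (\<Sum>i. r i powr t)"
      using bound[OF t(1,2)] by blast
    have "\<exists>U r. radius_cover t A U r \<and> (\<Sum>i. r i powr t) \<le> 1 / (2 * C)"
    proof (rule hausdorff_measure_zero_cover[OF s(2,1) t(3,4)])
      show "0 < 1 / (2 * C)" using C(1) by simp
      fix U r assume "A \<subseteq> (\<Union>i. U i)" "\<And>i. bounded (U i)" "\<And>i. diameter (U i) \<le> r i" "\<And>i. 0 < r i"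
        "summable (\<lambda>i. r i powr t)" "(\<Sum>i. r i powr t) \<le> 1 / (2 * C)"
      then have "radius_cover t A U r \<and> (\<Sum>i. r i powr t) \<le> 1 / (2 * C)" by (simp add: radius_cover_def)
      then show ?thesis by blast
    qed
    then obtain U r where U: "radius_cover t A U r" "(\<Sum>i. r i powr t) \<le> 1 / (2 * C)" by blast
    have "1 \<le> C * (\<Sum>i. r i powr t)" by (rule C(2)[OF U(1)])
    also have "\<dots> \<le> C * (1 / (2 * C))" using U(2) C(1) by (intro mult_left_mono) auto
    finally show False using C(1) by simp
  qed
qed

text \<open>The threshold 4/3 arises here: the product is of order
  \<open>k powr (3*t/2 - 2)\<close>, and this exponent is negative exactly for
  \<open>t < 4/3\<close>. The factor \<open>2 powr (t/2)\<close> comes from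
  \<open>k + 1 \<le> 2 * k\<close>.\<close>

lemma eventually_powr_bound:
  fixes t a :: real
  assumes "0 < t" "t < 4/3" "0 < a"
  shows "\<forall>\<^sub>F k in sequentially. (real k + 1) powr (t/2) * real k powr (t - 2) \<le> a"
proof -
  have "((\<lambda>k. real k powr (3*t/2 - 2)) \<longlongrightarrow> 0) sequentially"
    using assms by (intro tendsto_neg_powr filterlim_real_sequentially) auto
  then have "((\<lambda>k. 2 powr (t/2) * real k powr (3*t/2 - 2)) \<longlongrightarrow> 2 powr (t/2) * 0) sequentially"
    by (intro tendsto_mult tendsto_const)
  then have "\<forall>\<^sub>F k in sequentially. 2 powr (t/2) * real k powr (3*t/2 - 2) < a"
    using assms by (intro order_tendstoD) auto
  then show ?thesis
    using eventually_ge_at_top[of 1]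
  proof eventually_elim
    case (elim k)
    have "(real k + 1) powr (t/2) \<le> (2 * real k) powr (t/2)"
      using elim assms by (intro powr_mono2) auto
    also have "\<dots> = 2 powr (t/2) * real k powr (t/2)" by (rule powr_mult)
    finally have "(real k + 1) powr (t/2) * real k powr (t - 2) \<le> 2 powr (t/2) * real k powr (t/2) * real k powr (t - 2)"
      by (rule mult_right_mono) simp
    also have "\<dots> = 2 powr (t/2) * real k powr (3*t/2 - 2)"
      unfolding mult.assoc powr_add[symmetric] by (simp add: field_simps)
    finally show ?case using elim by linarith
  qed
qed

section \<open>The Weierstrass function of a triangular lattice\<close>

definition om :: complex where "om = cis (2 * pi / 3)"
text \<open>The primitive sixth root of unity \<open>cis (pi / 3)\<close>, written through
  \<open>om\<close> so that all products reduce by \<open>om_square\<close>.\<close>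

definition zeta :: complex where "zeta = 1 + om"

lemma om_complex: "om = Complex (-1/2) (sqrt 3 / 2)"
  by (simp add: om_def complex_eq_iff cos_120 sin_120)

lemma om_square: "om^2 = -1 - om"
  by (simp add: om_complex complex_eq_iff power2_eq_square)

lemma om_cube: "om^3 = 1"
proof -
  have "om^3 = om^2 * om" by (simp add: power3_eq_cube power2_eq_square)
  also have "\<dots> = - om - om^2" unfolding om_square[symmetric] by (subst om_square) (simp add: power2_eq_square algebra_simps)
  also have "\<dots> = 1" by (simp add: om_square)
  finally show ?thesis .
qed

lemma norm_om [simp]: "norm om = 1" by (simp add: om_def)

lemma om_nonzero [simp]: "om \<noteq> 0" using norm_om by fastforce

lemma zeta_powers: "zeta^2 = om" "zeta^3 = -1" "zeta^4 = -1 - om" "zeta^5 = - om"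
proof -
  show 2: "zeta^2 = om" using om_square by (simp add: zeta_def power2_eq_square algebra_simps)
  show 3: "zeta^3 = -1"
    using 2 om_square by (simp add: power3_eq_cube power2_eq_square zeta_def algebra_simps)
  show "zeta^4 = -1 - om" using 2 om_square power_mult[of zeta 2 2] by simp
  show "zeta^5 = - om" using 2 3 power_add[of zeta 2 3] by simp
qed

lemma norm_zeta [simp]: "norm zeta = 1"
proof -
  have "norm zeta ^ 2 = 1 ^ 2" using zeta_powers(1) norm_power[of zeta 2] by simp
  then show ?thesis by (metis norm_ge_zero power2_eq_imp_eq zero_le_one)
qed

lemma norm_om_comb: "norm (of_real x + of_real y * om :: complex)^2 = x^2 - x*y + y^2"
  unfolding cmod_power2 by (simp add: om_complex power2_eq_square field_simps)

text \<open>In this basis the mixed term has a positive sign, so nothing cancels for nonnegative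
  coordinates. This is why lattice points are sorted into sectors of angle
  \<open>pi / 3\<close>.\<close>

lemma norm_zeta_comb: "norm (of_real x + of_real y * zeta :: complex)^2 = x^2 + x*y + y^2"
proof -
  have "of_real x + of_real y * zeta = of_real (x + y) + of_real y * om"
    by (simp add: zeta_def algebra_simps)
  then show ?thesis using norm_om_comb[of "x + y" y] by (simp add: power2_eq_square algebra_simps)
qed

text \<open>Each sector contains its first bounding ray but not its second; this is the reason for
  \<open>Suc p\<close> beside \<open>q\<close>, and it lets the six sectors tile the lattice without
  the origin.\<close>

lemma hexagonal_sector:
  fixes a b :: int
  assumes "a \<noteq> 0 \<or> b \<noteq> 0"
  obtains k p q :: nat where "k < 6"
    "of_int a + of_int b * om = zeta^k * (of_nat (Suc p) + of_nat q * zeta)"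
proof -
  have o: "om * om = -1 - om" using om_square by (simp add: power2_eq_square)
  have o': "om * (om * x) = - x - om * x" for x
    using o by (metis (no_types) mult.assoc left_diff_distrib mult_minus_left mult_1)
  note sims = zeta_def algebra_simps o o'
  consider (0) "b \<ge> 0" "a > b" | (1) "a > 0" "a \<le> b" | (2) "a \<le> 0" "b > 0" | (3) "a < b" "b \<le> 0"
    | (4) "b \<le> a" "a < 0" | (5) "a \<ge> 0" "b < 0" using assms by linarith
  then show ?thesis
  proof cases
    case 0
    with that[of 0 "nat (a - b - 1)" "nat b"] show ?thesis by (simp add: sims)
  next
    case 1
    with that[of 1 "nat (a - 1)" "nat (b - a)"] show ?thesis by (simp add: sims)
  next
    case 2
    with that[of 2 "nat (b - 1)" "nat (- a)"] show ?thesis by (simp add: zeta_powers) (simp add: sims)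
  next
    case 3
    with that[of 3 "nat (b - a - 1)" "nat (- b)"] show ?thesis by (simp add: zeta_powers) (simp add: sims)
  next
    case 4
    with that[of 4 "nat (- a - 1)" "nat (a - b)"] show ?thesis by (simp add: zeta_powers) (simp add: sims)
  next
    case 5
    with that[of 5 "nat (- b - 1)" "nat a"] show ?thesis by (simp add: zeta_powers) (simp add: sims)
  qed
qed

section \<open>Arithmetic of the lattice and lattice sums\<close>

locale triangular_lattice =
  fixes l :: complex
  assumes l_nonzero: "l \<noteq> 0"
begin

definition L where "L = lattice l (om * l)"

lemma in_L_iff: "w \<in> L \<longleftrightarrow> (\<exists>a b. w = l * (of_int a + of_int b * om))"
  by (auto simp: L_def lattice_def algebra_simps)

lemma L_zero [simp]: "0 \<in> L"
  unfolding in_L_iff by (intro exI[of _ 0]) simp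

lemma L_add: "v \<in> L \<Longrightarrow> w \<in> L \<Longrightarrow> v + w \<in> L"
proof -
  assume "v \<in> L" "w \<in> L"
  then obtain a b c d where "v = l * (of_int a + of_int b * om)" "w = l * (of_int c + of_int d * om)"
    unfolding in_L_iff by blast
  then have "v + w = l * (of_int (a + c) + of_int (b + d) * om)" by (simp add: algebra_simps)
  then show ?thesis unfolding in_L_iff by blast
qed

lemma L_uminus: "w \<in> L \<Longrightarrow> - w \<in> L"
proof -
  assume "w \<in> L"
  then obtain a b where "w = l * (of_int a + of_int b * om)" unfolding in_L_iff by blast
  then have "- w = l * (of_int (- a) + of_int (- b) * om)" by (simp add: algebra_simps)
  then show ?thesis unfolding in_L_iff by blast
qed

lemma L_uminus_iff [simp]: "- w \<in> L \<longleftrightarrow> w \<in> L"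
  using L_uminus[of w] L_uminus[of "- w"] by auto

lemma L_diff: "v \<in> L \<Longrightarrow> w \<in> L \<Longrightarrow> v - w \<in> L"
  using L_add[of v "- w"] by simp

lemma L_add_iff: "w \<in> L \<Longrightarrow> z + w \<in> L \<longleftrightarrow> z \<in> L"
  using L_add[of z w] L_diff[of "z + w" w] by auto

lemma L_l [simp]: "l \<in> L"
  unfolding in_L_iff by (rule exI[of _ 1], rule exI[of _ 0]) simp

lemma L_om: "w \<in> L \<Longrightarrow> om * w \<in> L"
proof -
  assume "w \<in> L"
  then obtain a b where w: "w = l * (of_int a + of_int b * om)" by (auto simp: in_L_iff)
  have "om * w = l * (of_int a * om + of_int b * om^2)" by (simp add: w algebra_simps power2_eq_square)
  also have "\<dots> = l * (of_int (-b) + of_int (a - b) * om)" by (simp add: om_square algebra_simps)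
  finally show ?thesis unfolding in_L_iff by blast
qed

lemma L_om_iff [simp]: "om * w \<in> L \<longleftrightarrow> w \<in> L"
proof
  assume "om * w \<in> L"
  then have "om * (om * (om * w)) \<in> L" by (rule L_om[OF L_om])
  moreover have "om * (om * (om * w)) = om^3 * w" by (simp add: power3_eq_cube)
  ultimately show "w \<in> L" by (metis om_cube mult_1)
qed (rule L_om)

lemma bij_L_mult:
  assumes "\<And>w. c * w \<in> L \<longleftrightarrow> w \<in> L" "c \<noteq> 0"
  shows "bij_betw ((*) c) (L - {0}) (L - {0})"
  by (rule bij_betw_byWitness[where f' = "\<lambda>w. w / c"]) (use assms assms(1)[of "_ / c"] in auto)

text \<open>The form \<open>a^2 - a*b + b^2\<close> is integral and positive definite, so it is at
  least 1 off the origin, and \<open>l\<close> is a shortest period.\<close>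

lemma norm_L_ge:
  assumes "w \<in> L" "w \<noteq> 0"
  shows "norm l \<le> norm w"
proof -
  obtain a b where w: "w = l * (of_int a + of_int b * om)" using assms by (auto simp: in_L_iff)
  then have ab: "a \<noteq> 0 \<or> b \<noteq> 0" using assms by auto
  have "1 \<le> norm (of_int a + of_int b * om :: complex)^2"
  proof -
    have "4 * (a^2 - a*b + b^2) = (2*a-b)^2 + 3*b^2" by (simp add: power2_eq_square algebra_simps)
    moreover have "(2*a-b)^2 + 3*b^2 > 0"
    proof (cases "b = 0")
      case False
      then have "0 < b^2" by simp
      then show ?thesis using zero_le_power2[of "2*a-b"] by linarith
    qed (use ab in simp)
    ultimately have "0 < 4 * (a^2 - a*b + b^2)" by linarith
    then have "1 \<le> a^2 - a*b + b^2" unfolding zero_less_mult_iff by linarith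
    then have "(1::real) \<le> of_int (a^2 - a*b + b^2)" by linarith
    then show ?thesis using norm_om_comb[of "of_int a" "of_int b"] by simp
  qed
  then have "1 \<le> norm (of_int a + of_int b * om :: complex)" by (intro power2_le_imp_le[of 1]) auto
  then show ?thesis unfolding w norm_mult by (metis mult.right_neutral mult_left_mono norm_ge_zero)
qed

lemma small_notin_L: "u \<noteq> 0 \<Longrightarrow> norm u < norm l \<Longrightarrow> u \<notin> L"
  using norm_L_ge by force

lemma half_l_notin_L: "l / 2 \<notin> L"
  using l_nonzero by (intro small_notin_L) (auto simp: norm_divide)

text \<open>The lattice splits into six sectors, the rotations of \<open>l * (p + 1 + q * zeta)\<close>, on which the squared
  norm is at least \<open>(p + 1) * (q + 1)\<close>, so that negative powers are dominated by products.\<close>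
lemma L_summable:
  fixes F :: "complex \<Rightarrow> real" and u :: "nat \<Rightarrow> real"
  assumes F0: "\<And>w. 0 \<le> F w"
    and F: "\<And>k p q. F (l * (zeta^k * (of_nat (Suc p) + of_nat q * zeta))) \<le> u p * u q"
    and u0: "\<And>p. 0 \<le> u p" and U: "\<And>n. sum u {..<n} \<le> U"
  shows "F summable_on (L - {0})" and "infsum F (L - {0}) \<le> 6 * U^2"
proof -
  define c where "c = (\<lambda>(k,p,q). l * (zeta^k * (of_nat (Suc p) + of_nat q * zeta)))"
  have bd: "sum F A \<le> 6 * U^2" if A: "finite A" "A \<subseteq> L - {0}" for A
  proof -
    have "\<exists>i. fst i < 6 \<and> w = c i" if wA: "w \<in> A" for w
    proof -
      have "w \<in> L" "w \<noteq> 0" using wA A by auto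
      then obtain a b where w: "w = l * (of_int a + of_int b * om)" and "w \<noteq> 0"
        unfolding in_L_iff by blast
      then have "a \<noteq> 0 \<or> b \<noteq> 0" by auto
      then obtain k p q where "k < 6" "of_int a + of_int b * om = zeta^k * (of_nat (Suc p) + of_nat q * zeta)"
        by (rule hexagonal_sector)
      then show ?thesis using w by (intro exI[of _ "(k,p,q)"]) (simp add: c_def)
    qed
    then obtain i where i: "\<And>w. w \<in> A \<Longrightarrow> fst (i w) < 6 \<and> w = c (i w)" by metis
    \<comment> \<open>The sum of all coordinates is a crude bound for each of them; it puts the
      finite set inside one box of indices.\<close>
    define n where "n = Suc (\<Sum>w\<in>A. fst (snd (i w)) + snd (snd (i w)))"
    let ?I = "{..<6::nat} \<times> {..<n} \<times> {..<n}"
    have "w \<in> c ` ?I" if "w \<in> A" for w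
    proof (rule image_eqI)
      have "fst (snd (i w)) + snd (snd (i w)) \<le> (\<Sum>w\<in>A. fst (snd (i w)) + snd (snd (i w)))"
        using that A(1) by (intro member_le_sum) auto
      then show "i w \<in> ?I" using i[OF that] by (auto simp: n_def mem_Times_iff)
    qed (use i that in blast)
    then have "sum F A \<le> sum F (c ` ?I)" using F0 by (intro sum_mono2) auto
    also have "\<dots> \<le> sum (F \<circ> c) ?I" by (rule sum_image_le) (use F0 in auto)
    also have "\<dots> \<le> (\<Sum>(k,p,q)\<in>?I. u p * u q)"
      using F by (intro sum_mono) (auto simp: c_def)
    also have "\<dots> = 6 * (sum u {..<n} * sum u {..<n})"
      by (simp add: sum.cartesian_product[symmetric] sum_product)
    also have "\<dots> \<le> 6 * (U * U)"
      using U[of n] sum_nonneg[of "{..<n}" u] u0 by (intro mult_left_mono mult_mono) (auto intro: order_trans)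
    finally show ?thesis by (simp add: power2_eq_square)
  qed
  show "F summable_on (L - {0})"
    by (rule nonneg_bdd_above_summable_on) (use F0 bd in \<open>auto intro!: bdd_aboveI2\<close>)
  then show "infsum F (L - {0}) \<le> 6 * U^2"
    by (rule infsum_le_finite_sums) (use bd in auto)
qed

lemma sector_norm: "real (Suc p) * real (Suc q) \<le> (norm (l * (zeta^k * (of_nat (Suc p) + of_nat q * zeta))) / norm l)^2"
proof -
  have "(norm (l * (zeta^k * (of_nat (Suc p) + of_nat q * zeta))) / norm l)^2
      = norm (of_real (real (Suc p)) + of_real (real q) * zeta :: complex)^2"
    using l_nonzero by (simp add: norm_mult norm_power)
  also have "\<dots> = (real (Suc p))^2 + real (Suc p) * real q + (real q)^2" by (rule norm_zeta_comb)
  also have "\<dots> \<ge> real (Suc p) * real (Suc q)"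
    by (simp add: power2_eq_square algebra_simps)
  finally show ?thesis .
qed

lemma L_summable_cube: "(\<lambda>w. 1 / norm w^3) summable_on (L - {0})"
proof -
  \<comment> \<open>The cube of the norm is the power 3/2 of its square, and the square dominates
    the product of the two coordinates; each factor is then a convergent power series of exponent
    3/2.\<close>
  define u where "u p = real (Suc p) powr (-3/2)" for p :: nat
  have "summable u" unfolding u_def
    using summable_Suc_iff[of "\<lambda>n. real n powr (-3/2)"] by (simp add: summable_real_powr_iff)
  then have U: "sum u {..<n} \<le> suminf u" for n
    by (intro sum_le_suminf) (auto simp: u_def)
  have "(\<lambda>w. (norm l / norm w)^3) summable_on (L - {0})"
  proof (rule L_summable(1)[where u = u])
    fix k p q :: nat
    let ?w = "l * (zeta^k * (of_nat (Suc p) + of_nat q * zeta))"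
    define x where "x = norm ?w / norm l"
    have x: "real (Suc p) * real (Suc q) \<le> x^2" unfolding x_def by (rule sector_norm)
    have pos: "0 < real (Suc p) * real (Suc q)" by simp
    have "x \<noteq> 0" using less_le_trans[OF pos x] by auto
    moreover have "0 \<le> x" by (simp add: x_def)
    ultimately have x0: "0 < x" by simp
    have "(norm l / norm ?w)^3 = (x^2) powr (-3/2)"
    proof -
      have "x^2 = x powr 2" using x0 by simp
      then have "(x^2) powr (-3/2) = x powr (-3)" by (simp only: powr_powr) simp
      also have "\<dots> = 1 / x^3" using x0 by (simp add: powr_minus_divide powr_numeral)
      finally show ?thesis by (simp add: x_def power_divide)
    qed
    also have "\<dots> \<le> (real (Suc p) * real (Suc q)) powr (-3/2)"
      by (rule powr_mono2'[OF _ pos x]) simp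
    also have "\<dots> = u p * u q" unfolding u_def by (rule powr_mult)
    finally show "(norm l / norm ?w)^3 \<le> u p * u q" .
  qed (use U in \<open>auto simp: u_def\<close>)
  then have "(\<lambda>w. (norm l / norm w)^3 * (1 / norm l^3)) summable_on (L - {0})"
    by (rule summable_on_cmult_left)
  then show ?thesis using l_nonzero by (simp add: power_divide)
qed

text \<open>The proof that \<open>wp L (l / 2)\<close> is nonzero needs an explicit bound below 12.
  Here \<open>75/8\<close> is \<open>6 * (5/4)^2\<close>, and \<open>5/4\<close> bounds the sum of
  the inverse cubes: from the second term on, \<open>1/x^3\<close> is at most
  \<open>1/((x-1)*x*(x+1))\<close>, which telescopes to \<open>1/4\<close>.\<close>

lemma L_sum_sixth:
  shows "(\<lambda>w. (norm l / norm w)^6) summable_on (L - {0})"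
    and "(\<Sum>\<^sub>\<infinity>w\<in>L - {0}. (norm l / norm w)^6) \<le> 75/8"
proof -
  define u where "u p = 1 / real (Suc p)^3" for p :: nat
  have tel: "sum u {..<Suc n} \<le> 5/4 - 1 / (2 * real (Suc n) * real (Suc (Suc n)))" for n
  proof (induction n)
    case (Suc n)
    have "1 / real (Suc (Suc n))^3 + 1 / (2 * real (Suc (Suc n)) * real (Suc (Suc (Suc n))))
        \<le> 1 / (2 * real (Suc n) * real (Suc (Suc n)))"
    proof -
      define x where "x = real (Suc (Suc n))"
      have x: "x > 1" by (simp add: x_def)
      have e: "x * (x - 1) * (x + 1) = x * x * x - x" by (simp add: algebra_simps)
      have p: "x * (x - 1) * (x + 1) > 0" using x by simp
      have "x \<noteq> 0" "x - 1 \<noteq> 0" "x + 1 \<noteq> 0" using x by auto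
      then have "1 / (2 * (x - 1) * x) - 1 / (2 * x * (x + 1)) = 1 / (x * (x - 1) * (x + 1))"
        by (simp add: divide_simps)
      moreover have "1 / x^3 \<le> 1 / (x * (x - 1) * (x + 1))"
        using x p e by (intro frac_le) (auto simp: power3_eq_cube)
      ultimately have "1 / x^3 + 1 / (2 * x * (x + 1)) \<le> 1 / (2 * (x - 1) * x)" by linarith
      moreover have "real (Suc n) = x - 1" "real (Suc (Suc (Suc n))) = x + 1" by (auto simp: x_def)
      ultimately show ?thesis by (simp add: x_def)
    qed
    moreover have "u (Suc n) = 1 / real (Suc (Suc n))^3" by (simp add: u_def)
    moreover have "sum u {..<Suc (Suc n)} = sum u {..<Suc n} + u (Suc n)" by (rule sum.lessThan_Suc)
    ultimately show ?case using Suc by linarith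
  qed (simp add: u_def)
  have U: "sum u {..<n} \<le> 5/4" for n
  proof -
    have "sum u {..<n} \<le> sum u {..<Suc n}" by (intro sum_mono2) (auto simp: u_def)
    moreover have "0 \<le> 1 / (2 * real (Suc n) * real (Suc (Suc n)))" by simp
    ultimately show ?thesis using tel[of n] by linarith
  qed
  have F: "(norm l / norm (l * (zeta^k * (of_nat (Suc p) + of_nat q * zeta))))^6 \<le> u p * u q" for k p q
  proof -
    define W where "W = l * (zeta^k * (of_nat (Suc p) + of_nat q * zeta))"
    define x where "x = norm W / norm l"
    have x: "real (Suc p) * real (Suc q) \<le> x^2" unfolding x_def W_def by (rule sector_norm)
    have "(real (Suc p) * real (Suc q))^3 \<le> (x^2)^3" using x by (intro power_mono) auto
    moreover have "(x^2)^3 = x^6" by (simp flip: power_mult)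
    ultimately have "(real (Suc p) * real (Suc q))^3 \<le> x^6" by simp
    then have "1 / x^6 \<le> 1 / (real (Suc p) * real (Suc q))^3" by (intro frac_le) auto
    also have "\<dots> = u p * u q" unfolding u_def power_mult_distrib by simp
    finally show ?thesis unfolding x_def W_def[symmetric] by (simp add: power_divide)
  qed
  have u0: "0 \<le> u p" for p by (simp add: u_def)
  show "(\<lambda>w. (norm l / norm w)^6) summable_on (L - {0})"
    by (rule L_summable(1)[OF _ F u0 U]) simp
  have "(\<Sum>\<^sub>\<infinity>w\<in>L - {0}. (norm l / norm w)^6) \<le> 6 * (5/4)^2"
    by (rule L_summable(2)[OF _ F u0 U]) simp
  then show "(\<Sum>\<^sub>\<infinity>w\<in>L - {0}. (norm l / norm w)^6) \<le> 75/8" by (simp add: power2_eq_square)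
qed

section \<open>Convergence, symmetry and periodicity of the Weierstrass function\<close>

text \<open>Merges two facts into one constant: \<open>z\<close> has a positive distance
  \<open>d\<close> from the discrete set \<open>L\<close>, and the distance to \<open>w\<close>
  grows linearly in \<open>norm w\<close>. It makes the terms of the series comparable with
  \<open>1 / norm w^3\<close> on all of \<open>L - {0}\<close>.\<close>

lemma L_gap:
  assumes "z \<notin> L"
  obtains c where "0 < c" "\<And>w. w \<in> L \<Longrightarrow> c * norm w \<le> norm (z - w)"
proof -
  have "\<exists>d>0. \<forall>w\<in>L. d \<le> norm (z - w)"
  proof (cases "\<exists>v\<in>L. norm (z - v) < norm l / 2")
    case True
    then obtain v where v: "v \<in> L" "norm (z - v) < norm l / 2" by blast
    have "norm (z - v) \<le> norm (z - w)" if w: "w \<in> L" for w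
    proof (cases "w = v")
      case False
      then have "norm l \<le> norm (w - v)" using w v by (intro norm_L_ge L_diff) auto
      also have "\<dots> \<le> norm (z - v) + norm (z - w)" using norm_triangle_ineq4[of "z - v" "z - w"] by simp
      finally show ?thesis using v by linarith
    qed simp
    moreover have "0 < norm (z - v)" using v assms by auto
    ultimately show ?thesis by blast
  next
    case False
    then show ?thesis using l_nonzero by (intro exI[of _ "norm l / 2"]) force
  qed
  then obtain d where d: "0 < d" "\<And>w. w \<in> L \<Longrightarrow> d \<le> norm (z - w)" by blast
  show ?thesis
  proof
    show "0 < d / (norm z + d)" using d by (simp add: add_nonneg_pos)
    fix w assume "w \<in> L"
    have "norm w \<le> norm z + norm (z - w)" using norm_triangle_ineq4[of z "z - w"] by simp
    then have "d * norm w \<le> d * norm z + d * norm (z - w)" using d by (simp flip: distrib_left)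
    also have "\<dots> \<le> norm (z - w) * norm z + d * norm (z - w)"
      using d(2)[OF \<open>w \<in> L\<close>] by (intro add_mono mult_right_mono) auto
    finally show "d / (norm z + d) * norm w \<le> norm (z - w)"
      using add_nonneg_pos[OF norm_ge_zero d(1), of z] by (simp add: pos_divide_le_eq algebra_simps)
  qed
qed

lemma summable_of_cube_bound:
  fixes f :: "complex \<Rightarrow> complex"
  assumes "\<And>w. w \<in> L \<Longrightarrow> w \<noteq> 0 \<Longrightarrow> norm (f w) \<le> K * (1 / norm w^3)"
  shows "f summable_on (L - {0})" "norm (infsum f (L - {0})) \<le> K * (\<Sum>\<^sub>\<infinity>w\<in>L - {0}. 1 / norm w^3)"
proof -
  have g: "(\<lambda>w. K * (1 / norm w^3)) summable_on (L - {0})"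
    by (intro summable_on_cmult_right L_summable_cube)
  have a: "(\<lambda>w. norm (f w)) summable_on (L - {0})"
    by (rule summable_on_comparison_test[OF g]) (use assms in auto)
  then show s: "f summable_on (L - {0})" by (rule abs_summable_summable)
  have "norm (infsum f (L - {0})) \<le> (\<Sum>\<^sub>\<infinity>w\<in>L - {0}. K * (1 / norm w^3))"
    by (rule norm_infsum_le[OF has_sum_infsum[OF s] has_sum_infsum[OF g]]) (use assms in auto)
  then show "norm (infsum f (L - {0})) \<le> K * (\<Sum>\<^sub>\<infinity>w\<in>L - {0}. 1 / norm w^3)"
    by (simp only: infsum_cmult_right[OF L_summable_cube])
qed

lemma wp_term_summable:
  assumes "z \<notin> L"
  shows "(\<lambda>w. 1 / (z - w)^2 - 1 / w^2) summable_on (L - {0})"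
proof -
  obtain c where c: "0 < c" "\<And>w. w \<in> L \<Longrightarrow> c * norm w \<le> norm (z - w)" using L_gap[OF assms] by blast
  define K where "K = norm z * (2 + norm z / norm l) / c^2"
  show ?thesis
  proof (rule summable_of_cube_bound(1)[where K = K])
    fix w assume w: "w \<in> L" "w \<noteq> 0"
    have zw: "z - w \<noteq> 0" using assms w by auto
    have "1 / (z - w)^2 - 1 / w^2 = z * (2 * w - z) / ((z - w)^2 * w^2)"
      using zw w by (simp add: divide_simps) (simp add: power2_eq_square algebra_simps)
    also have "norm \<dots> = norm z * norm (2 * w - z) / (norm (z - w)^2 * norm w^2)"
      by (simp add: norm_mult norm_divide norm_power)
    also have "\<dots> \<le> norm z * ((2 + norm z / norm l) * norm w) / ((c * norm w)^2 * norm w^2)"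
    proof (rule frac_le)
      have "norm (2 * w - z) \<le> 2 * norm w + norm z" using norm_triangle_ineq4[of "2*w" z] by (simp add: norm_mult)
      also have "norm z \<le> norm z / norm l * norm w"
        using mult_right_mono[OF norm_L_ge[OF w], of "norm z"] l_nonzero by (simp add: pos_le_divide_eq mult.commute)
      finally have "norm (2 * w - z) \<le> (2 + norm z / norm l) * norm w" by (simp add: algebra_simps)
      then show "norm z * norm (2 * w - z) \<le> norm z * ((2 + norm z / norm l) * norm w)"
        by (intro mult_left_mono) auto
      show "(c * norm w)^2 * norm w^2 \<le> norm (z - w)^2 * norm w^2"
        using c(2)[OF w(1)] c(1) by (intro mult_right_mono power_mono) auto
    qed (use c w in auto)
    also have "\<dots> = K * (1 / norm w^3)"
      using w c by (simp add: K_def power2_eq_square power3_eq_cube)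
    finally show "norm (1 / (z - w)^2 - 1 / w^2) \<le> K * (1 / norm w^3)" .
  qed
qed

text \<open>In a difference of two values the corrections \<open>1 / w^2\<close> cancel and the
  principal part becomes the term at \<open>w = 0\<close>. The sum then runs over all of
  \<open>L\<close>, where translation by a period is a mere reindexing.\<close>

lemma wp_diff_has_sum:
  assumes "z \<notin> L" "z' \<notin> L"
  shows "((\<lambda>w. 1 / (z - w)^2 - 1 / (z' - w)^2) has_sum (wp L z - wp L z')) L"
proof -
  have 1: "((\<lambda>w. 1 / (z - w)^2 - 1 / w^2) has_sum (wp L z - 1 / z^2)) (L - {0})" if "z \<notin> L" for z
    using has_sum_infsum[OF wp_term_summable[OF that]] by (simp add: wp_def)
  have "((\<lambda>w. (1 / (z - w)^2 - 1 / w^2) + - (1 / (z' - w)^2 - 1 / w^2)) has_sum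
      ((wp L z - 1 / z^2) + - (wp L z' - 1 / z'^2))) (L - {0})"
    by (intro has_sum_add has_sum_uminusI 1 assms)
  then have "((\<lambda>w. 1 / (z - w)^2 - 1 / (z' - w)^2) has_sum
      ((wp L z - 1 / z^2) - (wp L z' - 1 / z'^2))) (L - {0})" by (simp add: algebra_simps)
  from has_sum_insert[OF _ this, of 0] show ?thesis
    by (simp add: insert_absorb algebra_simps)
qed

lemma wp_diff_shift:
  assumes "z \<notin> L" "z' \<notin> L" "v \<in> L"
  shows "wp L (z + v) - wp L (z' + v) = wp L z - wp L z'"
proof -
  have "((\<lambda>w. 1 / (z + v - w)^2 - 1 / (z' + v - w)^2) has_sum (wp L (z + v) - wp L (z' + v))) L"
    using assms by (intro wp_diff_has_sum) (auto simp: L_add_iff)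
  moreover have "bij_betw (\<lambda>w. w + v) L L"
    by (rule bij_betw_byWitness[where f' = "\<lambda>w. w - v"]) (use assms in \<open>auto intro: L_add L_diff\<close>)
  ultimately have "((\<lambda>w. 1 / (z - w)^2 - 1 / (z' - w)^2) has_sum (wp L (z + v) - wp L (z' + v))) L"
    by (subst (asm) has_sum_reindex_bij_betw[symmetric, of "\<lambda>w. w + v" L L]) (auto simp: algebra_simps)
  then show ?thesis using wp_diff_has_sum[OF assms(1,2)] by (rule has_sum_unique)
qed

lemma wp_uminus: "wp L (- z) = wp L z"
proof -
  have "bij_betw uminus (L - {0}) (L - {0})"
    by (rule bij_betw_byWitness[where f' = uminus]) auto
  from infsum_reindex_bij_betw[OF this, of "\<lambda>w. 1 / (- z - w)^2 - 1 / w^2"]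
  have "(\<Sum>\<^sub>\<infinity>w\<in>L - {0}. 1 / (- z - w)^2 - 1 / w^2) = (\<Sum>\<^sub>\<infinity>w\<in>L - {0}. 1 / (- z - - w)^2 - 1 / (- w)^2)"
    by (rule sym)
  also have "\<dots> = (\<Sum>\<^sub>\<infinity>w\<in>L - {0}. 1 / (z - w)^2 - 1 / w^2)"
    by (rule infsum_cong) (simp add: power2_commute)
  finally show ?thesis by (simp add: wp_def)
qed

lemma wp_om: "wp L (om * z) = om * wp L z"
proof -
  have om_inverse_square: "1 / (om * x)^2 = om * (1 / x^2)" for x
  proof -
    have "1 / om^2 = om" using om_cube by (simp add: field_simps power3_eq_cube power2_eq_square)
    then show ?thesis by (simp add: power_mult_distrib divide_simps split: if_splits)
  qed
  have "bij_betw ((*) om) (L - {0}) (L - {0})" by (rule bij_L_mult) auto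
  from infsum_reindex_bij_betw[OF this, of "\<lambda>w. 1 / (om * z - w)^2 - 1 / w^2"]
  have "(\<Sum>\<^sub>\<infinity>w\<in>L - {0}. 1 / (om * z - w)^2 - 1 / w^2)
      = (\<Sum>\<^sub>\<infinity>w\<in>L - {0}. 1 / (om * (z - w))^2 - 1 / (om * w)^2)" by (simp add: right_diff_distrib)
  also have "\<dots> = (\<Sum>\<^sub>\<infinity>w\<in>L - {0}. om * (1 / (z - w)^2 - 1 / w^2))"
    unfolding om_inverse_square by (simp only: right_diff_distrib)
  also have "\<dots> = om * (\<Sum>\<^sub>\<infinity>w\<in>L - {0}. 1 / (z - w)^2 - 1 / w^2)"
    by (rule infsum_cmult_right')
  finally show ?thesis unfolding wp_def om_inverse_square by (simp only: distrib_left)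
qed

text \<open>By \<open>wp_diff_shift\<close> the increment of \<open>wp\<close> along a period \<open>v\<close> is constant; it vanishes at \<open>- v / 2\<close>
  because \<open>wp\<close> is even, provided that this point is not itself in the lattice.\<close>
lemma wp_periodic:
  assumes "z \<notin> L" "v \<in> L"
  shows "wp L (z + v) = wp L z"
proof -
  have half: "wp L (z + v) = wp L z" if "z \<notin> L" "v \<in> L" "v / 2 \<notin> L" for z v
  proof -
    have "- (v / 2) + v = v / 2" by simp
    then show ?thesis using wp_diff_shift[of z "- (v / 2)" v] that wp_uminus[of "v / 2"] by simp
  qed
  show ?thesis
  proof (cases "v / 2 \<in> L")
    case True
    have "(v - l) / 2 \<notin> L"
    proof
      assume "(v - l) / 2 \<in> L"
      from L_diff[OF True this] have "l / 2 \<in> L" by (simp add: diff_divide_distrib)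
      then show False using half_l_notin_L by simp
    qed
    then have "wp L (z + (v - l)) = wp L z" using assms by (intro half L_diff) auto
    moreover have "wp L (z + (v - l) + l) = wp L (z + (v - l))"
      using assms half_l_notin_L by (intro half) (auto simp: L_add_iff L_diff)
    ultimately show ?thesis by simp
  qed (use half assms in blast)
qed

section \<open>The regular part at a pole\<close>

definition wp_regular :: "complex \<Rightarrow> complex" where
  "wp_regular u = (\<Sum>\<^sub>\<infinity>w\<in>L - {0}. 1 / (u - w)^2 - 1 / w^2)"

text \<open>The factor 8 rounds up \<open>640/81 = (5/2) / (3/4)^4\<close> from the estimate in
  \<open>wp_regular_lipschitz\<close>.\<close>

definition wp_lip :: real where
  "wp_lip = 8 * (\<Sum>\<^sub>\<infinity>w\<in>L - {0}. 1 / norm w^3)"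

lemma wp_lip_nonneg: "0 \<le> wp_lip"
  unfolding wp_lip_def by (intro mult_nonneg_nonneg infsum_nonneg) auto

lemma wp_regular_zero [simp]: "wp_regular 0 = 0"
  by (simp add: wp_regular_def)

lemma wp_near_lattice:
  assumes "v \<in> L" "u \<noteq> 0" "norm u < norm l"
  shows "wp L (v + u) = 1 / u^2 + wp_regular u"
  using wp_periodic[of u v] small_notin_L[of u] assms by (simp add: wp_def wp_regular_def add.commute)

text \<open>Estimated term by term, without derivatives: as \<open>norm l\<close> is the shortest
  length, points of modulus at most \<open>norm l / 4\<close> stay at distance
  \<open>3/4 * norm w\<close> from every nonzero \<open>w\<close>, so each difference is a multiple
  of \<open>norm (u - u') / norm w^3\<close>.\<close>

lemma wp_regular_lipschitz:
  assumes u: "norm u \<le> norm l / 4" and u': "norm u' \<le> norm l / 4"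
  shows "norm (wp_regular u - wp_regular u') \<le> wp_lip * norm (u - u')"
proof -
  have summ: "(\<lambda>w. 1 / (u - w)^2 - 1 / w^2) summable_on (L - {0})" if "norm u \<le> norm l / 4" for u
  proof (cases "u = 0")
    case False
    moreover have "norm u < norm l" using that l_nonzero zero_less_norm_iff[of l] by linarith
    ultimately show ?thesis by (intro wp_term_summable small_notin_L)
  qed simp
  have "wp_regular u - wp_regular u' =
      (\<Sum>\<^sub>\<infinity>w\<in>L - {0}. (1 / (u - w)^2 - 1 / w^2) + - (1 / (u' - w)^2 - 1 / w^2))"
    unfolding wp_regular_def
    by (subst infsum_add) (use summ[OF u] summ[OF u'] in \<open>auto simp: infsum_uminus summable_on_uminus simp del: minus_diff_eq\<close>)
  also have "\<dots> = (\<Sum>\<^sub>\<infinity>w\<in>L - {0}. 1 / (u - w)^2 - 1 / (u' - w)^2)" by simp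
  also have "norm \<dots> \<le> (8 * norm (u - u')) * (\<Sum>\<^sub>\<infinity>w\<in>L - {0}. 1 / norm w^3)"
  proof (rule summable_of_cube_bound(2))
    fix w assume w: "w \<in> L" "w \<noteq> 0"
    define x where "x = norm w"
    have x: "norm l \<le> x" "0 < x" using norm_L_ge[OF w] w by (auto simp: x_def)
    have a: "3/4 * x \<le> norm (u - w)" "3/4 * x \<le> norm (u' - w)"
      using norm_triangle_ineq2[of w u] norm_triangle_ineq2[of w u'] u u' x
      by (auto simp: x_def norm_minus_commute)
    have b: "norm (u + u' - 2 * w) \<le> 5/2 * x"
      using norm_triangle_ineq4[of "u + u'" "2 * w"] norm_triangle_ineq[of u u'] u u' x
      by (auto simp: x_def norm_mult)
    have nz: "u - w \<noteq> 0" "u' - w \<noteq> 0" using a x by auto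
    have "1 / (u - w)^2 - 1 / (u' - w)^2 = - ((u - u') * (u + u' - 2 * w) / ((u - w)^2 * (u' - w)^2))"
      using nz by (simp add: divide_simps) (simp add: power2_eq_square algebra_simps)
    also have "norm \<dots> = norm (u - u') * norm (u + u' - 2 * w) / (norm (u - w)^2 * norm (u' - w)^2)"
      by (simp only: norm_minus_cancel norm_mult norm_divide norm_power)
    also have "\<dots> \<le> norm (u - u') * (5/2 * x) / ((3/4 * x)^2 * (3/4 * x)^2)"
      using a b x by (intro frac_le mult_mono power_mono) auto
    also have "\<dots> = (640/81) * norm (u - u') / x^3"
      using x by (simp add: field_simps power2_eq_square power3_eq_cube)
    also have "\<dots> \<le> 8 * norm (u - u') / x^3"
      using x by (intro divide_right_mono mult_right_mono) auto
    finally show "norm (1 / (u - w)^2 - 1 / (u' - w)^2) \<le> 8 * norm (u - u') * (1 / norm w^3)"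
      by (simp add: x_def)
  qed
  also have "\<dots> = wp_lip * norm (u - u')" by (simp add: wp_lip_def)
  finally show ?thesis .
qed

end

section \<open>Averaging over the six rotations and the critical value\<close>

text \<open>The cofactor of \<open>y - a*x\<close> in \<open>y^3 - x^3\<close> makes the denominator
  the same for all three cube roots of unity. The numerator is sorted by powers of \<open>a\<close>,
  so that summation over the roots leaves only the part free of \<open>a\<close>.\<close>

lemma cube_root_partial_fraction:
  fixes a x y :: complex
  assumes a: "a^3 = 1" and ne: "y^3 \<noteq> x^3"
  shows "(y + a*x) / (y - a*x)^2 =
    (y^5 + 5*x^3*y^2 + a * (3*x*y^4 + 3*x^4*y) + a^2 * (5*x^2*y^3 + x^5)) / (y^3 - x^3)^2"
proof -
  have f: "(y - a*x) * (y^2 + a*x*y + a^2*x^2) = y^3 - x^3"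
    using a by (simp add: algebra_simps power2_eq_square power3_eq_cube)
  have nz: "y - a*x \<noteq> 0" "y^2 + a*x*y + a^2*x^2 \<noteq> 0" using f ne by auto
  have a4: "a^4 = a" "a^5 = a^2" using a by (simp_all add: eval_nat_numeral)
  have "(y + a*x) * (y^2 + a*x*y + a^2*x^2)^2 =
      y^5 + 5*a^3*x^3*y^2 + (3*a*x*y^4 + 3*a^4*x^4*y) + (5*a^2*x^2*y^3 + a^5*x^5)"
    by (simp add: eval_nat_numeral algebra_simps)
  also have "\<dots> = y^5 + 5*x^3*y^2 + a * (3*x*y^4 + 3*x^4*y) + a^2 * (5*x^2*y^3 + x^5)"
    by (simp add: a a4 algebra_simps)
  finally have num: "(y + a*x) * (y^2 + a*x*y + a^2*x^2)^2 = \<dots>" .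
  have "(y + a*x) / (y - a*x)^2 = ((y + a*x) * (y^2 + a*x*y + a^2*x^2)^2) / ((y - a*x) * (y^2 + a*x*y + a^2*x^2))^2"
    using nz by (simp add: power_mult_distrib)
  then show ?thesis unfolding f num .
qed

text \<open>Adding the terms at \<open>w\<close> and \<open>- w\<close> gives a function of
  \<open>w^2\<close>; summation over the cube roots of unity then removes all but the first group of
  the numerator, and also the corrections \<open>1 / w^2\<close>, by
  \<open>1 + om + om^2 = 0\<close>. The result decays like the sixth power, which makes an explicit
  numerical bound feasible.\<close>

lemma hexagonal_average:
  fixes z w :: complex
  defines "t \<equiv> \<lambda>w. 1 / (z - w)^2 - 1 / w^2"
  assumes w: "w \<noteq> 0" and ne: "z^6 \<noteq> w^6"
  shows "(t w + t (- w)) + (t (om * w) + t (- (om * w))) + (t (om^2 * w) + t (- (om^2 * w)))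
    = 6 * z^4 * (z^6 + 5 * w^6) / (z^6 - w^6)^2"
proof -
  define x y where "x = w^2" and "y = z^2"
  have x6: "x^3 = w^6" "y^3 = z^6" by (simp_all add: x_def y_def flip: power_mult)
  have x0: "x \<noteq> 0" using w by (simp add: x_def)
  have pair: "t (c * w) + t (- (c * w)) = 2 * ((y + c^2 * x) / (y - c^2 * x)^2) - 2 / (c^2 * x)"
    if "c^6 = 1" for c
  proof -
    have c0: "c \<noteq> 0" using that by auto
    have "(c * w)^6 = w^6" by (simp add: power_mult_distrib that)
    then have "z \<noteq> c * w" "z \<noteq> - (c * w)" using ne by (auto simp: power_mult_distrib)
    then have nz: "z - c * w \<noteq> 0" "z + c * w \<noteq> 0" by (auto simp: add_eq_0_iff)
    have d: "y - c^2 * x = (z - c*w) * (z + c*w)"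
      by (simp add: x_def y_def power2_eq_square algebra_simps)
    have i: "1 / (z - c*w)^2 + 1 / (z + c*w)^2 = 2 * ((y + c^2 * x) / (y - c^2 * x)^2)"
      unfolding d using nz
      by (simp add: divide_simps power_mult_distrib) (simp add: x_def y_def power2_eq_square algebra_simps)
    have ii: "1 / (c * w)^2 + 1 / (- (c * w))^2 = 2 / (c^2 * x)"
      by (simp add: x_def power_mult_distrib)
    have "t (c * w) + t (- (c * w)) = (1 / (z - c*w)^2 + 1 / (z + c*w)^2) - (1 / (c * w)^2 + 1 / (- (c * w))^2)"
      by (simp add: t_def)
    then show ?thesis unfolding i ii .
  qed
  have om6: "om^6 = 1" using power_mult[of om 3 2] om_cube by simp
  have om4: "(om^2)^2 = om" using om_cube by (simp add: power2_eq_square power3_eq_cube mult.assoc)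
  have pf: "(y + a*x) / (y - a*x)^2 =
    (y^5 + 5*x^3*y^2 + a * (3*x*y^4 + 3*x^4*y) + a^2 * (5*x^2*y^3 + x^5)) / (y^3 - x^3)^2" if "a^3 = 1" for a
    using that ne by (intro cube_root_partial_fraction) (simp_all add: x6)
  have om23: "(om^2)^3 = 1" using om6 by (simp flip: power_mult)
  have om26: "(om^2)^6 = 1" using om6 power_mult[of om 2 6] power_mult[of om 6 2] by simp
  let ?A = "y^5 + 5*x^3*y^2" and ?B = "3*x*y^4 + 3*x^4*y" and ?C = "5*x^2*y^3 + x^5" and ?D = "(y^3 - x^3)^2"
  have pp: "t (c * w) + t (- (c * w)) =
      2 * ((?A + c^2 * ?B + (c^2)^2 * ?C) / ?D) - 2 * (1 / (c^2 * x))" if "c^6 = 1" for c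
  proof -
    have "(c^2)^3 = 1" using that by (simp flip: power_mult)
    from pf[OF this] pair[OF that] show ?thesis by simp
  qed
  have lin: "(2*a - 2*b) + (2*c - 2*d) + (2*e - 2*f) = 2 * (a + c + e) - 2 * (b + d + f)"
    for a b c d e f :: complex by simp
  have one: "(1::complex)^6 = 1" "(1::complex)^2 = 1" "1 * x = x" by simp_all
  have "(t (1 * w) + t (- (1 * w))) + (t (om * w) + t (- (om * w))) + (t (om^2 * w) + t (- (om^2 * w)))
    = 2 * ((?A + 1 * ?B + 1 * ?C) / ?D + (?A + om^2 * ?B + om * ?C) / ?D + (?A + om * ?B + om^2 * ?C) / ?D)
      - 2 * (1 / x + 1 / (om^2 * x) + 1 / (om * x))"
    unfolding pp[OF one(1)] pp[OF om6] pp[of "om^2", OF om26, unfolded om4] om4 one lin by (rule refl)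
  also have "1 / x + 1 / (om^2 * x) + 1 / (om * x) = 0"
  proof -
    have i: "1 / om = om^2" "1 / om^2 = om"
      using om_cube by (simp_all add: field_simps power3_eq_cube power2_eq_square)
    have "1 / x + 1 / (om^2 * x) + 1 / (om * x) = (1 + 1 / om^2 + 1 / om) * (1 / x)"
      by (simp add: algebra_simps)
    also have "1 + 1 / om^2 + 1 / om = 0" unfolding i by (simp add: om_square)
    finally show ?thesis by simp
  qed
  also have "(?A + 1 * ?B + 1 * ?C) / ?D + (?A + om^2 * ?B + om * ?C) / ?D + (?A + om * ?B + om^2 * ?C) / ?D
      = 3 * ?A / ?D"
    unfolding om_square add_divide_distrib[symmetric] by (rule arg_cong[where f = "\<lambda>u. u / ?D"]) (simp add: algebra_simps)
  also have "2 * (3 * ?A / ?D) - 2 * 0 = 6 * y^2 * (y^3 + 5 * x^3) / (y^3 - x^3)^2"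
    by (simp add: eval_nat_numeral algebra_simps)
  finally show ?thesis by (simp add: x6) (simp add: y_def flip: power_mult)
qed

context triangular_lattice
begin

text \<open>Averaging the series over the six rotations leaves \<open>1 / z^2\<close>, of modulus \<open>4 / norm l^2\<close> at \<open>z = l / 2\<close>,
  plus a tail of modulus at most \<open>25 / (8 * norm l^2)\<close>.\<close>
lemma wp_half_nonzero: "wp L (l / 2) \<noteq> 0"
proof -
  define z where "z = l / 2"
  define t where "t w = 1 / (z - w)^2 - 1 / w^2" for w
  define T where "T = infsum t (L - {0})"
  have zL: "z \<notin> L" using half_l_notin_L by (simp add: z_def)
  have hs: "(t has_sum T) (L - {0})"
    unfolding T_def t_def by (rule has_sum_infsum[OF wp_term_summable[OF zL]])
  have rot: "((\<lambda>w. t (c * w)) has_sum T) (L - {0})" if "\<And>w. c * w \<in> L \<longleftrightarrow> w \<in> L" "c \<noteq> 0" for c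
    using hs has_sum_reindex_bij_betw[OF bij_L_mult[OF that], of t T] by simp
  have r: "((\<lambda>w. t (om * w)) has_sum T) (L - {0})" "((\<lambda>w. t (- (om * w))) has_sum T) (L - {0})"
    "((\<lambda>w. t (om^2 * w)) has_sum T) (L - {0})" "((\<lambda>w. t (- (om^2 * w))) has_sum T) (L - {0})"
    "((\<lambda>w. t (- w)) has_sum T) (L - {0})"
    using rot[of om] rot[of "- om"] rot[of "om^2"] rot[of "- (om^2)"] rot[of "- 1"]
    by (simp_all add: power2_eq_square mult.assoc)
  have "((\<lambda>w. (t w + t (- w)) + (t (om * w) + t (- (om * w))) + (t (om^2 * w) + t (- (om^2 * w))))
      has_sum ((T + T) + (T + T) + (T + T))) (L - {0})"
    by (intro has_sum_add hs r)
  moreover have "(T + T) + (T + T) + (T + T) = 6 * T" by simp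
  ultimately have six: "((\<lambda>w. (t w + t (- w)) + (t (om * w) + t (- (om * w))) + (t (om^2 * w) + t (- (om^2 * w))))
      has_sum (6 * T)) (L - {0})" by simp
  \<comment> \<open>The 2 rounds up \<open>6/16 * (321/64) / (63/64)^2\<close>, about 1.94. These
    numbers come from \<open>norm z = norm l / 2\<close>: it gives \<open>1/16\<close> for
    \<open>z^4\<close>, and it makes \<open>z^6\<close> at most \<open>1/64\<close> of
    \<open>w^6\<close> in modulus.\<close>
  define g where "g w = 2 / norm l^2 * (norm l / norm w)^6" for w :: complex
  have nl: "0 < norm l" using l_nonzero by simp
  have bound: "norm ((t w + t (- w)) + (t (om * w) + t (- (om * w))) + (t (om^2 * w) + t (- (om^2 * w)))) \<le> g w"
    if w: "w \<in> L - {0}" for w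
  proof -
    define n where "n = norm w"
    have n: "norm l \<le> n" "0 < n" using w norm_L_ge[of w] by (auto simp: n_def)
    have z6: "norm (z^6) \<le> n^6 / 64"
    proof -
      have "norm (z^6) = norm l^6 / 64" by (simp add: z_def norm_power norm_divide power_divide)
      also have "\<dots> \<le> n^6 / 64" using n by (intro divide_right_mono power_mono) auto
      finally show ?thesis .
    qed
    have n6: "norm (w^6) = n^6" "0 < n^6" using n by (simp_all add: n_def norm_power)
    have lo: "63/64 * n^6 \<le> norm (z^6 - w^6)"
      using norm_triangle_ineq2[of "w^6" "z^6"] z6 n6 by (simp add: norm_minus_commute)
    have hi: "norm (z^6 + 5 * w^6) \<le> 321/64 * n^6"
      using norm_triangle_ineq[of "z^6" "5 * w^6"] z6 n6 by (simp add: norm_mult)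
    have "z^6 \<noteq> w^6" using lo n6 by auto
    then have "norm ((t w + t (- w)) + (t (om * w) + t (- (om * w))) + (t (om^2 * w) + t (- (om^2 * w))))
        = norm (6 * z^4 * (z^6 + 5 * w^6) / (z^6 - w^6)^2)"
      using hexagonal_average[of w z] w unfolding t_def by simp
    also have "\<dots> = 6 / 16 * norm l^4 * norm (z^6 + 5 * w^6) / norm (z^6 - w^6)^2"
      by (simp add: norm_mult norm_divide norm_power z_def power_divide)
    also have "\<dots> \<le> 6 / 16 * norm l^4 * (321/64 * n^6) / (63/64 * n^6)^2"
      using lo hi n6 by (intro frac_le mult_left_mono power_mono) auto
    also have "\<dots> = (6/16 * (321/64) / (63/64)^2) * (norm l^4 / n^6)"
    proof -
      have "6 / 16 * a * (321/64 * N) / (63/64 * N)^2 = (6/16 * (321/64) / (63/64)^2) * (a / N)"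
        if "0 < N" for a N :: real using that by (simp add: power2_eq_square)
      then show ?thesis using n6(2) .
    qed
    also have "\<dots> \<le> 2 * (norm l^4 / n^6)"
      using n6 by (intro mult_right_mono) (auto simp: power2_eq_square)
    also have "\<dots> = g w"
      using nl n by (simp add: g_def n_def[symmetric] field_simps eval_nat_numeral)
    finally show ?thesis .
  qed
  have gsum: "g summable_on (L - {0})"
    unfolding g_def by (intro summable_on_cmult_right L_sum_sixth)
  have "norm (6 * T) \<le> infsum g (L - {0})"
    by (rule norm_infsum_le[OF six has_sum_infsum[OF gsum] bound])
  also have "infsum g (L - {0}) = 2 / norm l^2 * (\<Sum>\<^sub>\<infinity>w\<in>L - {0}. (norm l / norm w)^6)"
    unfolding g_def by (rule infsum_cmult_right[OF L_sum_sixth(1)])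
  also have "\<dots> \<le> 2 / norm l^2 * (75/8)"
    by (intro mult_left_mono L_sum_sixth) auto
  finally have "norm T \<le> 25/8 * (1 / norm l^2)" by (simp add: norm_mult)
  also have "\<dots> < 4 * (1 / norm l^2)" using nl by (intro mult_strict_right_mono) auto
  also have "\<dots> = norm (1 / z^2)" by (simp add: z_def norm_divide norm_power power_divide)
  finally have "1 / z^2 + T \<noteq> 0" by (metis add_eq_0_iff less_irrefl norm_minus_cancel)
  then show ?thesis by (simp add: wp_def z_def T_def t_def[abs_def])
qed

end

section \<open>Inverse branches along the critical orbit\<close>

lemma almost_linear_bounds:
  fixes F :: "complex \<Rightarrow> complex"
  assumes F: "norm (F w - F w' - A * (w - w')) \<le> norm A / 4 * norm (w - w')"
  shows "3/4 * norm A * norm (w - w') \<le> norm (F w - F w')"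
    and "norm (F w - F w') \<le> 5/4 * norm A * norm (w - w')"
  using F norm_triangle_ineq2[of "A * (w - w')" "F w - F w'"]
    norm_triangle_ineq2[of "F w - F w'" "A * (w - w')"]
  by (auto simp: norm_mult norm_minus_commute)

text \<open>A Newton iteration with fixed slope \<open>A\<close> takes the place of the inverse
  function theorem. Its map \<open>T\<close> contracts by \<open>1/4\<close>; it moves the centre by
  at most \<open>3/4 * r\<close>, so the ball is mapped into itself.\<close>

lemma almost_linear_surj:
  fixes F :: "complex \<Rightarrow> complex"
  assumes F: "\<And>w w'. w \<in> cball c r \<Longrightarrow> w' \<in> cball c r \<Longrightarrow>
      norm (F w - F w' - A * (w - w')) \<le> norm A / 4 * norm (w - w')"
    and A: "A \<noteq> 0" and r: "0 \<le> r"
  shows "cball (F c) (3/4 * norm A * r) \<subseteq> F ` cball c r"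
proof
  fix y assume y: "y \<in> cball (F c) (3/4 * norm A * r)"
  define T where "T w = w - (F w - y) / A" for w
  have contr: "dist (T w) (T w') \<le> 1/4 * dist w w'" if "w \<in> cball c r" "w' \<in> cball c r" for w w'
  proof -
    have "T w - T w' = - ((F w - F w' - A * (w - w')) / A)"
      using A by (simp add: T_def field_simps)
    then have "norm (T w - T w') = norm (F w - F w' - A * (w - w')) / norm A"
      by (simp add: norm_divide del: minus_diff_eq)
    also have "\<dots> \<le> (norm A / 4 * norm (w - w')) / norm A"
      by (intro divide_right_mono F that) simp
    finally show ?thesis using A by (simp add: dist_norm)
  qed
  have "\<exists>!w\<in>cball c r. T w = w"
  proof (rule Banach_fix[where c = "1/4"])
    show "complete (cball c r)" by (simp add: compact_imp_complete)
    show "T ` cball c r \<subseteq> cball c r"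
    proof safe
      fix w assume w: "w \<in> cball c r"
      have c: "c \<in> cball c r" using r by simp
      have "dist c (T w) \<le> dist c (T c) + dist (T c) (T w)" by (rule dist_triangle)
      also have "dist c (T c) = norm (F c - y) / norm A" by (simp add: T_def dist_norm norm_divide)
      also have "\<dots> \<le> 3/4 * r" using y A by (simp add: dist_norm field_simps)
      also have "dist (T c) (T w) \<le> 1/4 * dist c w" by (rule contr[OF c w])
      finally show "T w \<in> cball c r" using w by simp
    qed
  qed (use r contr in auto)
  then obtain w where "w \<in> cball c r" "T w = w" by auto
  then show "y \<in> F ` cball c r" using A by (auto simp: T_def)
qed

lemma inverse_square_bounds:
  fixes u :: complex and \<rho> :: real
  assumes \<rho>: "0 < \<rho>" and u: "norm (u - \<rho>) \<le> \<rho> / 100"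
  shows "norm u \<le> 101/100 * \<rho>" "99/100 * \<rho> \<le> norm u"
    "norm (1 / u^2) \<le> 2 / \<rho>^2" "9/10 / \<rho>^2 \<le> norm (1 / u^2)"
proof -
  show 1: "norm u \<le> 101/100 * \<rho>" using norm_triangle_ineq2[of u "of_real \<rho>"] u \<rho> by simp
  show 2: "99/100 * \<rho> \<le> norm u" using norm_triangle_ineq3[of u "of_real \<rho>"] u \<rho> by simp
  have "norm (1 / u^2) = 1 / norm u^2" by (simp add: norm_divide norm_power)
  also have "\<dots> \<le> 1 / (99/100 * \<rho>)^2" using 2 \<rho> by (intro frac_le power_mono) auto
  also have "\<dots> \<le> 2 / \<rho>^2" using \<rho> by (simp add: power2_eq_square field_simps)
  finally show "norm (1 / u^2) \<le> 2 / \<rho>^2" .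
  have "u \<noteq> 0" using 2 \<rho> by auto
  have "9/10 / \<rho>^2 \<le> 1 / (101/100 * \<rho>)^2" using \<rho> by (simp add: power2_eq_square field_simps)
  also have "\<dots> \<le> 1 / norm u^2" using 1 \<open>u \<noteq> 0\<close> by (intro frac_le power_mono) auto
  also have "\<dots> = norm (1 / u^2)" by (simp add: norm_divide norm_power)
  finally show "9/10 / \<rho>^2 \<le> norm (1 / u^2)" .
qed

text \<open>The slope of \<open>1 / u^2\<close> at \<open>\<rho>\<close> is
  \<open>- 2 / \<rho>^3\<close>. Writing \<open>u = \<rho> * (1 + a)\<close> removes the scale; the
  constant \<open>1/8\<close> is then \<open>(12/100) / (96/100)\<close>.\<close>

lemma inverse_square_almost_linear:
  fixes u u' :: complex and \<rho> :: real
  assumes \<rho>: "0 < \<rho>" and u: "norm (u - \<rho>) \<le> \<rho> / 100" and u': "norm (u' - \<rho>) \<le> \<rho> / 100"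
  shows "norm (1 / u^2 - 1 / u'^2 + 2 / \<rho>^3 * (u - u')) \<le> 1 / (8 * \<rho>^3) * norm (u - u')"
proof -
  define a a' where "a = u / \<rho> - 1" and "a' = u' / \<rho> - 1"
  have ua: "u = \<rho> * (1 + a)" "u' = \<rho> * (1 + a')" using \<rho> by (auto simp: a_def a'_def)
  have "u - \<rho> = \<rho> * a" "u' - \<rho> = \<rho> * a'" by (auto simp: ua algebra_simps)
  then have a: "norm a \<le> 1/100" "norm a' \<le> 1/100" using u u' \<rho> by (auto simp: norm_mult)
  define q where "q = a + a' + a * a'"
  have q: "norm q \<le> 1/100 + 1/100 + 1/100 * (1/100)"
    unfolding q_def by (intro order_trans[OF norm_triangle_ineq] add_mono a) (use mult_mono[OF a] in \<open>simp add: norm_mult\<close>)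
  have nz: "1 + a \<noteq> 0" "1 + a' \<noteq> 0"
    using a by (auto simp: add_eq_0_iff)
  have q1: "(1 + a) * (1 + a') = 1 + q" by (simp add: q_def algebra_simps)
  have q2: "norm (2 * (2 * q + q^2) - (a + a')) \<le> 12/100"
  proof -
    have "norm (2 * (2 * q + q^2) - (a + a')) \<le> norm (2 * (2 * q + q^2)) + norm (a + a')"
      by (rule norm_triangle_ineq4)
    also have "norm (2 * (2 * q + q^2)) \<le> 2 * (2 * norm q + norm q^2)"
      using norm_triangle_ineq[of "2*q" "q^2"] by (simp add: norm_mult norm_power del: distrib_left_numeral)
    also have "norm q^2 \<le> (201/10000)^2" using q by (intro power_mono) auto
    also have "norm (a + a') \<le> 2/100" using norm_triangle_ineq[of a a'] a by simp
    finally show ?thesis using q by (simp add: power2_eq_square)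
  qed
  have q3: "96/100 \<le> norm ((1 + q)^2)"
  proof -
    have "98/100 - 1/10000 \<le> norm (1 + q)" using norm_triangle_ineq2[of 1 "- q"] q by simp
    then have "(98/100 - 1/10000)^2 \<le> norm (1 + q)^2" by (intro power_mono) auto
    then show ?thesis by (simp add: norm_mult power2_eq_square)
  qed
  have u0: "u \<noteq> 0" "u' \<noteq> 0" using ua nz \<rho> by auto
  have "1 / u^2 - 1 / u'^2 = - ((u - u') * ((u + u') / (u * u')^2))"
    using u0 by (simp add: divide_simps) (simp add: power2_eq_square algebra_simps)
  also have "(u + u') / (u * u')^2 = (2 + a + a') / (\<rho>^3 * (1 + q)^2)"
  proof -
    have "u * u' = \<rho>^2 * (1 + q)" by (simp add: ua q1[symmetric] power2_eq_square)
    moreover have "u + u' = \<rho> * (2 + a + a')" by (simp add: ua algebra_simps)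
    ultimately show ?thesis using \<rho> by (simp add: power_mult_distrib power2_eq_square power3_eq_cube)
  qed
  finally have "1 / u^2 - 1 / u'^2 + 2 / \<rho>^3 * (u - u')
      = (u - u') * (2 / \<rho>^3 - (2 + a + a') / (\<rho>^3 * (1 + q)^2))"
    by (simp add: algebra_simps)
  also have "2 / \<rho>^3 - (2 + a + a') / (\<rho>^3 * (1 + q)^2)
      = (2 * (2 * q + q^2) - (a + a')) / (\<rho>^3 * (1 + q)^2)"
  proof -
    have "(1 + q)^2 \<noteq> 0" using q3 by auto
    then have "2 / \<rho>^3 = 2 * (1 + q)^2 / (\<rho>^3 * (1 + q)^2)" by simp
    then show ?thesis by (simp add: diff_divide_distrib[symmetric] power2_eq_square algebra_simps)
  qed
  also have "norm ((u - u') * \<dots>) = norm (u - u') * (norm (2 * (2 * q + q^2) - (a + a')) / (\<rho>^3 * norm ((1 + q)^2)))"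
    using \<rho> by (simp add: norm_mult norm_divide norm_power)
  also have "\<dots> \<le> norm (u - u') * ((12/100) / (\<rho>^3 * (96/100)))"
    using q2 q3 \<rho> by (intro mult_left_mono frac_le) auto
  also have "\<dots> = 1 / (8 * \<rho>^3) * norm (u - u')" using \<rho> by simp
  finally show ?thesis .
qed

context triangular_lattice
begin

section \<open>One step of the construction near a pole\<close>

text \<open>Here \<open>h w\<close> is the parameter whose current iterate is \<open>w\<close>, so
  \<open>h w * wp L w\<close> is its next iterate. Near the pole \<open>wp\<close> has size
  \<open>\<rho>^(-2)\<close> and slope \<open>\<rho>^(-3)\<close>; the variation of the parameter
  contributes about \<open>M * \<rho>^(-2)\<close> against \<open>norm B * \<rho>^(-3)\<close>,
  which is small by \<open>M * \<rho> \<le> norm B / 32\<close>.\<close>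

lemma wp_almost_linear:
  fixes h :: "complex \<Rightarrow> complex" and \<rho> :: real
  defines "D \<equiv> \<lambda>v. cball (v + of_real \<rho>) (\<rho> / 100)"
  assumes v: "v \<in> L" and \<rho>: "0 < \<rho>" "\<rho> \<le> norm l / 64" "wp_lip * \<rho>^3 \<le> 1/16" "M * \<rho> \<le> norm B / 32"
    and B: "B \<noteq> 0" and M: "0 \<le> M"
    and h: "\<And>w. w \<in> D v \<Longrightarrow> norm (h w - B) \<le> norm B / 32"
    and hM: "\<And>w w'. w \<in> D v \<Longrightarrow> w' \<in> D v \<Longrightarrow> norm (h w - h w') \<le> M * norm (w - w')"
  shows "\<And>w w'. w \<in> D v \<Longrightarrow> w' \<in> D v \<Longrightarrow>
      norm (h w * wp L w - h w' * wp L w' - (- 2 * B / \<rho>^3) * (w - w'))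
        \<le> norm (- 2 * B / \<rho>^3) / 4 * norm (w - w')"
    and "\<And>w. w \<in> D v \<Longrightarrow> norm B / (2 * \<rho>^2) \<le> norm (h w * wp L w)"
proof -
  define f where "f u = 1 / u^2 + wp_regular u" for u
  have w_u: "norm ((w - v) - \<rho>) \<le> \<rho> / 100" if "w \<in> D v" for w
    using that by (simp add: D_def dist_norm norm_minus_commute algebra_simps)
  have rl: "101/100 * \<rho> \<le> norm l / 4" "101/100 * \<rho> < norm l" using \<rho> by auto
  have wpf: "wp L w = f (w - v)" if "w \<in> D v" for w
  proof -
    have "w - v \<noteq> 0" "norm (w - v) < norm l"
      using inverse_square_bounds(1,2)[OF \<rho>(1) w_u[OF that]] \<rho>(1) rl by auto
    then show ?thesis using wp_near_lattice[OF v, of "w - v"] by (simp add: f_def)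
  qed
  have small: "norm (w - v) \<le> norm l / 4" if "w \<in> D v" for w
    using inverse_square_bounds(1)[OF \<rho>(1) w_u[OF that]] rl by linarith
  have reg: "norm (wp_regular (w - v)) \<le> 1 / (8 * \<rho>^2)" if "w \<in> D v" for w
  proof -
    have "norm (wp_regular (w - v)) \<le> wp_lip * norm (w - v)"
      using wp_regular_lipschitz[OF small[OF that], of 0] by simp
    also have "\<dots> \<le> wp_lip * (2 * \<rho>)"
      using inverse_square_bounds(1)[OF \<rho>(1) w_u[OF that]] \<rho> wp_lip_nonneg by (intro mult_left_mono) auto
    also have "\<dots> = 2 * (wp_lip * \<rho>^3) / \<rho>^2" using \<rho> by (simp add: power2_eq_square power3_eq_cube)
    also have "\<dots> \<le> 2 * (1/16) / \<rho>^2" using \<rho> by (intro divide_right_mono mult_left_mono) auto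
    finally show ?thesis by simp
  qed
  have hB: "norm (h w) \<le> 33/32 * norm B" "31/32 * norm B \<le> norm (h w)" if "w \<in> D v" for w
    using h[OF that] norm_triangle_ineq2[of "h w" B] norm_triangle_ineq2[of B "h w"]
    by (auto simp: norm_minus_commute)
  show "norm B / (2 * \<rho>^2) \<le> norm (h w * wp L w)" if w: "w \<in> D v" for w
  proof -
    have "norm (1 / (w - v)^2) - norm (wp_regular (w - v)) \<le> norm (f (w - v))"
      unfolding f_def by (metis norm_diff_ineq)
    moreover have "9/10 / \<rho>^2 - 1 / (8 * \<rho>^2) = (31/40) / \<rho>^2" using \<rho> by (simp add: field_simps)
    ultimately have "(31/40) / \<rho>^2 \<le> norm (f (w - v))"
      using inverse_square_bounds(4)[OF \<rho>(1) w_u[OF w]] reg[OF w] by linarith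
    then have "(31/32 * norm B) * ((31/40) / \<rho>^2) \<le> norm (h w) * norm (f (w - v))"
      using hB[OF w] by (intro mult_mono) auto
    moreover have "norm B / (2 * \<rho>^2) = (norm B * (1/2)) / \<rho>^2" by simp
    moreover have "(norm B * (1/2)) / \<rho>^2 \<le> (norm B * (31/32 * (31/40))) / \<rho>^2"
      by (intro divide_right_mono mult_left_mono) auto
    moreover have "(norm B * (31/32 * (31/40))) / \<rho>^2 = (31/32 * norm B) * ((31/40) / \<rho>^2)" by simp
    ultimately show ?thesis by (simp only: norm_mult wpf[OF w])
  qed
  show "norm (h w * wp L w - h w' * wp L w' - (- 2 * B / \<rho>^3) * (w - w'))
        \<le> norm (- 2 * B / \<rho>^3) / 4 * norm (w - w')" if w: "w \<in> D v" and w': "w' \<in> D v" for w w'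
  proof -
    define u u' where "u = w - v" and "u' = w' - v"
    have uu: "w - w' = u - u'" by (simp add: u_def u'_def)
    define n where "n = norm (u - u')"
    define E where "E = f u - f u' + 2 / \<rho>^3 * (u - u')"
    have E: "norm E \<le> (3 / 16) / \<rho>^3 * n"
    proof -
      have "E = (1 / u^2 - 1 / u'^2 + 2 / \<rho>^3 * (u - u')) + (wp_regular u - wp_regular u')"
        by (simp add: E_def f_def)
      also have "norm \<dots> \<le> 1 / (8 * \<rho>^3) * n + wp_lip * n"
        unfolding n_def u_def u'_def
        by (intro order_trans[OF norm_triangle_ineq] add_mono inverse_square_almost_linear
            wp_regular_lipschitz \<rho>(1) w_u small w w')
      also have "wp_lip \<le> (1/16) / \<rho>^3" using \<rho> by (simp add: field_simps)
      finally show ?thesis using \<rho> by (simp add: n_def mult_right_mono algebra_simps)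
    qed
    have fu': "norm (f u') \<le> 3 / \<rho>^2"
    proof -
      have "norm (f u') \<le> 2 / \<rho>^2 + 1 / (8 * \<rho>^2)"
        unfolding f_def u'_def
        by (intro order_trans[OF norm_triangle_ineq] add_mono inverse_square_bounds(3) \<rho>(1) w_u reg w')
      also have "\<dots> \<le> 3 / \<rho>^2" using \<rho> by (simp add: field_simps)
      finally show ?thesis .
    qed
    have n0: "0 \<le> n" by (simp add: n_def)
    have e1: "norm ((h w - B) * (- 2 / \<rho>^3 * (u - u'))) \<le> norm B / 32 * (2 / \<rho>^3 * n)"
      unfolding norm_mult using h[OF w] \<rho> by (intro mult_mono) (auto simp: n_def norm_divide norm_power)
    have e2: "norm (h w * E) \<le> 33/32 * norm B * ((3 / 16) / \<rho>^3 * n)"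
      unfolding norm_mult using hB[OF w] E by (intro mult_mono) auto
    have e3: "norm ((h w - h w') * f u') \<le> norm B / 32 * (3 / \<rho>^3 * n)"
    proof -
      have "norm ((h w - h w') * f u') \<le> (M * n) * (3 / \<rho>^2)"
        unfolding norm_mult using hM[OF w w'] fu' M n0 by (intro mult_mono) (auto simp: n_def uu)
      also have "\<dots> = (M * \<rho>) * (3 / \<rho>^3 * n)" using \<rho> by (simp add: power2_eq_square power3_eq_cube)
      also have "\<dots> \<le> norm B / 32 * (3 / \<rho>^3 * n)" using \<rho> n0 by (intro mult_right_mono) auto
      finally show ?thesis .
    qed
    \<comment> \<open>Three errors: the slope belongs to \<open>B\<close> instead of
      \<open>h w\<close>, \<open>wp\<close> is not linear, and \<open>h\<close> is not constant. In
      units of \<open>norm B * n / \<rho>^3\<close> they stay below the allowed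
      \<open>1/2\<close>.\<close>
    have "h w * wp L w - h w' * wp L w' - (- 2 * B / \<rho>^3) * (w - w')
        = (h w - B) * (- 2 / \<rho>^3 * (u - u')) + h w * E + (h w - h w') * f u'"
    proof -
      define k :: complex where "k = 2 / \<rho>^3"
      have k: "- 2 * B / \<rho>^3 = - (B * k)" "- 2 / \<rho>^3 = - k" "2 / \<rho>^3 = k"
        by (simp_all add: k_def)
      show ?thesis
        unfolding wpf[OF w] wpf[OF w'] u_def[symmetric] u'_def[symmetric] uu E_def k
        by (simp add: algebra_simps)
    qed
    also have "norm \<dots> \<le> norm B / 32 * (2 / \<rho>^3 * n) + 33/32 * norm B * ((3 / 16) / \<rho>^3 * n) + norm B / 32 * (3 / \<rho>^3 * n)"
      by (intro order_trans[OF norm_triangle_ineq] add_mono e1 e2 e3)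
    also have "\<dots> = (2/32 + 33/32 * (3/16) + 3/32) * (norm B * n / \<rho>^3)"
      using \<rho> by (simp add: field_simps)
    also have "\<dots> \<le> 1/2 * (norm B * n / \<rho>^3)"
      using \<rho> n0 by (intro mult_right_mono) auto
    also have "\<dots> = norm (- 2 * B / \<rho>^3) / 4 * norm (w - w')"
      using \<rho> by (simp add: n_def uu norm_mult norm_divide norm_power)
    finally show ?thesis .
  qed
qed

lemma lattice_near:
  obtains v where "v \<in> L" "norm (y - v) \<le> 2 * norm l"
proof -
  define b where "b = Im (y / l) * 2 / sqrt 3"
  define a where "a = Re (y / l) + b / 2"
  have yl: "y / l = of_real a + of_real b * om"
    by (simp add: om_complex complex_eq_iff a_def b_def)
  define v where "v = l * (of_int \<lfloor>a\<rfloor> + of_int \<lfloor>b\<rfloor> * om)"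
  have "y = l * (of_real a + of_real b * om)" using yl l_nonzero by (simp add: field_simps)
  then have "y - v = l * (of_real (frac a) + of_real (frac b) * om)"
    by (simp add: v_def frac_def algebra_simps)
  also have "norm \<dots> \<le> norm l * (frac a + frac b)"
    unfolding norm_mult[of l] using norm_triangle_ineq[of "of_real (frac a)" "of_real (frac b) * om"]
    by (intro mult_left_mono) (auto simp: norm_mult)
  also have "\<dots> \<le> norm l * 2"
    using frac_lt_1[of a] frac_lt_1[of b] by (intro mult_left_mono) auto
  finally have "norm (y - v) \<le> 2 * norm l" by simp
  moreover have "v \<in> L" unfolding in_L_iff v_def by blast
  ultimately show ?thesis using that by blast
qed

text \<open>Completing the square in the norm form bounds each coordinate by the norm; distances
  between children are later read as differences of grid indices.\<close>

lemma lattice_coord_bound: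
  "\<bar>a\<bar> * norm l \<le> 2 * norm (l * (of_real a + of_real b * om))"
  "\<bar>b\<bar> * norm l \<le> 2 * norm (l * (of_real a + of_real b * om))"
proof -
  let ?n = "norm (of_real a + of_real b * om :: complex)"
  have n: "?n^2 = a^2 - a*b + b^2" by (rule norm_om_comb)
  have "a^2 \<le> (2 * ?n)^2"
  proof -
    have "(2 * ?n)^2 = (2*b - a)^2 + 3*a^2" unfolding power_mult_distrib n by (simp add: power2_eq_square algebra_simps)
    then show ?thesis using zero_le_power2[of "2*b-a"] zero_le_power2[of a] by linarith
  qed
  then have a: "\<bar>a\<bar> \<le> 2 * ?n" by (metis abs_le_square_iff abs_of_nonneg norm_ge_zero mult_nonneg_nonneg zero_le_numeral)
  have "b^2 \<le> (2 * ?n)^2"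
  proof -
    have "(2 * ?n)^2 = (2*a - b)^2 + 3*b^2" unfolding power_mult_distrib n by (simp add: power2_eq_square algebra_simps)
    then show ?thesis using zero_le_power2[of "2*a-b"] zero_le_power2[of b] by linarith
  qed
  then have b: "\<bar>b\<bar> \<le> 2 * ?n" by (metis abs_le_square_iff abs_of_nonneg norm_ge_zero mult_nonneg_nonneg zero_le_numeral)
  show "\<bar>a\<bar> * norm l \<le> 2 * norm (l * (of_real a + of_real b * om))"
    "\<bar>b\<bar> * norm l \<le> 2 * norm (l * (of_real a + of_real b * om))"
    using mult_right_mono[OF a, of "norm l"] mult_right_mono[OF b, of "norm l"]
    by (auto simp: norm_mult mult.commute)
qed

text \<open>All new branches are restrictions of a single right inverse \<open>g\<close> of
  \<open>w \<mapsto> h w * wp L w\<close> on one large ball, so the lower Lipschitz bound also holds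
  between different children. It picks up the factor \<open>4/5 / \<Lambda>\<close>, while the upper
  bound \<open>M\<close> is kept. Two discs of radius \<open>\<epsilon>\<close> blur a difference of
  centres by \<open>norm l / 16\<close>, that is a grid coordinate by \<open>1/8\<close>, within the
  \<open>1/2\<close> of the conclusion.\<close>

lemma inverse_branches:
  fixes h :: "complex \<Rightarrow> complex" and \<rho> m M :: real and k :: nat
  defines "\<epsilon> \<equiv> norm l / 32"
  assumes v: "v \<in> L" and \<rho>: "0 < \<rho>" "\<rho> \<le> norm l / 64" "wp_lip * \<rho>^3 \<le> 1/16" "M * \<rho> \<le> norm B / 32"
    and B: "B \<noteq> 0" and M: "0 \<le> M" and m: "0 \<le> m"
    and h: "\<And>w. w \<in> cball v \<epsilon> \<Longrightarrow> norm (h w - B) \<le> norm B / 32"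
    and hm: "\<And>w w'. w \<in> cball v \<epsilon> \<Longrightarrow> w' \<in> cball v \<epsilon> \<Longrightarrow> m * norm (w - w') \<le> norm (h w - h w')"
    and hM: "\<And>w w'. w \<in> cball v \<epsilon> \<Longrightarrow> w' \<in> cball v \<epsilon> \<Longrightarrow> norm (h w - h w') \<le> M * norm (w - w')"
    and \<Lambda>: "\<Lambda> = 2 * norm B / \<rho>^3" "4/3 \<le> \<Lambda>" and k: "1 \<le> k" "3/4 * \<Lambda> * (\<rho> / 100) = 4 * norm l * real k"
  obtains g :: "complex \<Rightarrow> complex" and lam :: "nat \<times> nat \<Rightarrow> complex"
  where "\<And>p. lam p \<in> L"
    and "\<And>p w. p \<in> {..<k} \<times> {..<k} \<Longrightarrow> w \<in> cball (lam p) \<epsilon> \<Longrightarrow>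
      g w \<in> cball v \<epsilon> \<and> g w \<notin> L \<and> h (g w) * wp L (g w) = w \<and> norm B / (2 * \<rho>^2) \<le> norm w"
    and "\<And>p q w w'. \<lbrakk>p \<in> {..<k} \<times> {..<k}; q \<in> {..<k} \<times> {..<k}; w \<in> cball (lam p) \<epsilon>; w' \<in> cball (lam q) \<epsilon>\<rbrakk>
      \<Longrightarrow> m * (4/5 / \<Lambda>) * norm (w - w') \<le> norm (h (g w) - h (g w')) \<and> norm (h (g w) - h (g w')) \<le> M * norm (w - w')"
    and "\<And>p q w w'. \<lbrakk>w \<in> cball (lam p) \<epsilon>; w' \<in> cball (lam q) \<epsilon>\<rbrakk>
      \<Longrightarrow> \<bar>real (fst p) - real (fst q)\<bar> \<le> 1/2 + 2 * norm (w - w') / norm l \<and>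
          \<bar>real (snd p) - real (snd q)\<bar> \<le> 1/2 + 2 * norm (w - w') / norm l"
proof -
  have nl: "0 < norm l" using l_nonzero by simp
  define D where "D = cball (v + of_real \<rho>) (\<rho> / 100)"
  define A where "A = - 2 * B / complex_of_real (\<rho>^3)"
  define F where "F w = h w * wp L w" for w
  have nA: "norm A = \<Lambda>" using \<rho> \<Lambda> by (simp add: A_def norm_mult norm_divide norm_power)
  have A0: "A \<noteq> 0" using nA \<Lambda> by auto
  have wv: "norm (w - v) \<le> 101/100 * \<rho> \<and> 99/100 * \<rho> \<le> norm (w - v)" if "w \<in> D" for w
  proof -
    have "norm ((w - v) - of_real \<rho>) \<le> \<rho> / 100"
      using that by (simp add: D_def dist_norm norm_minus_commute algebra_simps)
    then show ?thesis using inverse_square_bounds(1,2)[OF \<rho>(1)] by blast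
  qed
  have Dsub: "D \<subseteq> cball v \<epsilon>"
    using wv \<rho> by (force simp: \<epsilon>_def dist_norm norm_minus_commute)
  have DL: "w \<notin> L" if "w \<in> D" for w
  proof -
    have "w - v \<notin> L" using wv[OF that] \<rho> nl by (intro small_notin_L) auto
    then show ?thesis using L_diff[OF _ v] by blast
  qed
  have hD: "norm (h w - B) \<le> norm B / 32" if "w \<in> D" for w
    using h that Dsub by blast
  have hMD: "norm (h w - h w') \<le> M * norm (w - w')" if "w \<in> D" "w' \<in> D" for w w'
    using hM that Dsub by blast
  note wal = wp_almost_linear[OF v \<rho> B M, of h, folded D_def, OF hD hMD]
  have Flin: "norm (F w - F w' - A * (w - w')) \<le> norm A / 4 * norm (w - w')" if "w \<in> D" "w' \<in> D" for w w'
    unfolding F_def A_def by (rule wal(1)) (use that in simp_all)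
  have Fbig: "norm B / (2 * \<rho>^2) \<le> norm (F w)" if "w \<in> D" for w
    unfolding F_def by (rule wal(2)) (use that in simp_all)
  define y where "y = F (v + of_real \<rho>)"
  have surj: "cball y (4 * norm l * real k) \<subseteq> F ` D"
    unfolding y_def D_def k(2)[symmetric] nA[symmetric]
    by (rule almost_linear_surj) (use Flin A0 \<rho> in \<open>auto simp: D_def\<close>)
  define g where "g = inv_into D F"
  have g: "g w \<in> D" "F (g w) = w" if "w \<in> cball y (4 * norm l * real k)" for w
    using surj that by (auto simp: g_def inv_into_into f_inv_into_f subset_iff)
  obtain v0 where v0: "v0 \<in> L" "norm (y - v0) \<le> 2 * norm l" by (rule lattice_near)
  define lam where "lam p = v0 + l * (of_nat (fst p) + of_nat (snd p) * om)" for p :: "nat \<times> nat"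
  have inball: "w \<in> cball y (4 * norm l * real k)" if p: "p \<in> {..<k} \<times> {..<k}" and w: "w \<in> cball (lam p) \<epsilon>" for p w
  proof -
    obtain i j where ij: "p = (i, j)" "i < k" "j < k" using p by auto
    have "norm (of_nat i + of_nat j * om :: complex) \<le> real i + real j"
      using norm_triangle_ineq[of "of_nat i" "of_nat j * om"] by (simp add: norm_mult)
    also have "\<dots> \<le> 2 * real k - 2" using ij by linarith
    finally have "norm l * norm (of_nat i + of_nat j * om :: complex) \<le> norm l * (2 * real k - 2)"
      by (intro mult_left_mono) auto
    then have 1: "dist v0 (lam p) \<le> norm l * (2 * real k - 2)"
      by (simp add: lam_def ij dist_norm norm_mult)
    have "dist y w \<le> dist y v0 + dist v0 (lam p) + dist (lam p) w"
      by (meson dist_triangle add_mono order_refl order_trans)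
    \<comment> \<open>Room in the ball: \<open>2 * norm l\<close> to the lattice point
      \<open>v0\<close> near the centre, then the extent of the grid, then the radius of a
      disc.\<close>
    also have "\<dots> \<le> 2 * norm l + norm l * (2 * real k - 2) + norm l / 32"
      using v0 w by (intro add_mono 1) (auto simp: dist_norm \<epsilon>_def)
    also have "\<dots> \<le> 4 * norm l * real k"
    proof -
      have "norm l * 1 \<le> norm l * real k" using k by (intro mult_left_mono) auto
      moreover have "norm l * (2 * real k - 2) = 2 * (norm l * real k) - 2 * norm l"
        "4 * norm l * real k = 4 * (norm l * real k)" by (simp_all add: algebra_simps)
      ultimately show ?thesis using nl by linarith
    qed
    finally show ?thesis by simp
  qed
  show ?thesis
  proof (rule that)
    show "lam p \<in> L" for p
    proof -
      have "l * (of_nat (fst p) + of_nat (snd p) * om) \<in> L"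
        unfolding in_L_iff by (intro exI[of _ "int (fst p)"] exI[of _ "int (snd p)"]) simp
      then show ?thesis unfolding lam_def by (intro L_add v0)
    qed
    show "g w \<in> cball v \<epsilon> \<and> g w \<notin> L \<and> h (g w) * wp L (g w) = w \<and> norm B / (2 * \<rho>^2) \<le> norm w"
      if "p \<in> {..<k} \<times> {..<k}" "w \<in> cball (lam p) \<epsilon>" for p w
    proof -
      have gw: "g w \<in> D" "F (g w) = w" using g inball[OF that] by auto
      have "norm B / (2 * \<rho>^2) \<le> norm w" using Fbig[OF gw(1)] unfolding gw(2) .
      then show ?thesis using gw Dsub DL by (auto simp: F_def)
    qed
    show "m * (4/5 / \<Lambda>) * norm (w - w') \<le> norm (h (g w) - h (g w')) \<and> norm (h (g w) - h (g w')) \<le> M * norm (w - w')"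
      if "p \<in> {..<k} \<times> {..<k}" "q \<in> {..<k} \<times> {..<k}" "w \<in> cball (lam p) \<epsilon>" "w' \<in> cball (lam q) \<epsilon>" for p q w w'
    proof
      note gw = g[OF inball[OF that(1,3)]] and gw' = g[OF inball[OF that(2,4)]]
      have gD: "g w \<in> cball v \<epsilon>" "g w' \<in> cball v \<epsilon>" using gw gw' Dsub by auto
      note b = almost_linear_bounds[OF Flin[OF gw(1) gw'(1)], unfolded gw(2) gw'(2) nA]
      have "(4/5 / \<Lambda>) * norm (w - w') \<le> norm (g w - g w')"
        using b(2) \<Lambda>(2) by (simp add: field_simps)
      then have "m * ((4/5 / \<Lambda>) * norm (w - w')) \<le> m * norm (g w - g w')"
        using m by (rule mult_left_mono)
      also have "\<dots> \<le> norm (h (g w) - h (g w'))" by (rule hm[OF gD])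
      finally show "m * (4/5 / \<Lambda>) * norm (w - w') \<le> norm (h (g w) - h (g w'))" by (simp add: mult.assoc)
      \<comment> \<open>The bound \<open>4/3 \<le> \<Lambda>\<close> makes the step expanding, so
        \<open>g\<close> does not increase distances and the constant \<open>M\<close>
        survives.\<close>
      have "1 * norm (g w - g w') \<le> 3/4 * \<Lambda> * norm (g w - g w')"
        using \<Lambda>(2) by (intro mult_right_mono) auto
      then have "norm (g w - g w') \<le> norm (w - w')" using b(1) by linarith
      then have "M * norm (g w - g w') \<le> M * norm (w - w')" using M by (rule mult_left_mono)
      then show "norm (h (g w) - h (g w')) \<le> M * norm (w - w')" using hM[OF gD] by linarith
    qed
    show "\<bar>real (fst p) - real (fst q)\<bar> \<le> 1/2 + 2 * norm (w - w') / norm l \<and>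
          \<bar>real (snd p) - real (snd q)\<bar> \<le> 1/2 + 2 * norm (w - w') / norm l"
      if "w \<in> cball (lam p) \<epsilon>" "w' \<in> cball (lam q) \<epsilon>" for p q w w'
    proof -
      define a b where "a = real (fst p) - real (fst q)" and "b = real (snd p) - real (snd q)"
      have e: "lam p - lam q = l * (of_real a + of_real b * om)"
        by (simp add: lam_def a_def b_def algebra_simps)
      have "norm (lam p - lam q) \<le> dist (lam p) w + norm (w - w') + dist (lam q) w'"
        using norm_triangle_ineq[of "lam p - w" "w - w'"] norm_triangle_ineq[of "lam p - w'" "w' - lam q"]
        by (simp add: dist_norm norm_minus_commute)
      then have n: "norm (lam p - lam q) \<le> norm (w - w') + norm l / 16" using that by (simp add: \<epsilon>_def)
      have "\<bar>a\<bar> * norm l \<le> 2 * norm (w - w') + norm l / 8" "\<bar>b\<bar> * norm l \<le> 2 * norm (w - w') + norm l / 8"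
        using lattice_coord_bound[where a = a and b = b] n unfolding e by linarith+
      then have "\<bar>a\<bar> \<le> 2 * norm (w - w') / norm l + 1/8" "\<bar>b\<bar> \<le> 2 * norm (w - w') / norm l + 1/8"
        using nl by (simp_all add: field_simps)
      then show ?thesis unfolding a_def b_def by linarith
    qed
  qed
qed

text \<open>At level \<open>n\<close> the pole is left along \<open>u = radius (K + n)\<close>; \<open>scale\<close> is chosen so that the image of the disc of
  radius \<open>radius k / 100\<close> contains a disc of radius \<open>4 * norm l * k\<close>, hence a grid of \<open>k * k\<close> lattice
  points (\<open>expansion_radius\<close>).\<close>
definition crit :: complex where "crit = wp L (l / 2)"
text \<open>The parameter for which the first image of \<open>l / 2\<close> is exactly the lattice
  point \<open>l\<close>; all pieces stay near it.\<close>

definition base :: complex where "base = l / crit"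
definition scale :: real where "scale = 3 / (800 * norm crit)"
definition radius :: "nat \<Rightarrow> real" where "radius k = sqrt (scale / real k)"
definition expansion :: "nat \<Rightarrow> real" where "expansion k = 2 * norm base / radius k^3"
definition admissible :: "nat \<Rightarrow> bool" where
  "admissible k \<longleftrightarrow> 2 \<le> k \<and> radius k \<le> norm l / 64 \<and> wp_lip * radius k^3 \<le> 1/16 \<and> 4/3 \<le> expansion k"
text \<open>The accumulated lower Lipschitz constant of the parametrisation at level
  \<open>n\<close>: \<open>1 / norm crit\<close> from the root, then one factor per inverse branch.
  At level \<open>n\<close> the children have spacing
  \<open>contraction K (Suc n) * norm l / 2\<close>.\<close>

definition contraction :: "nat \<Rightarrow> nat \<Rightarrow> real" where
  "contraction K n = (1 / norm crit) * (\<Prod>i<n. 4/5 / expansion (K + i))"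

text \<open>A node is a set of parameters on which the iterate of order \<open>n + 1\<close> of the critical point
  is injective with inverse \<open>h\<close>, mapping onto a small disc around the lattice point \<open>v\<close>.\<close>
definition node :: "nat \<Rightarrow> nat \<Rightarrow> complex set \<Rightarrow> bool" where
  "node K n S \<longleftrightarrow> (\<exists>v h. v \<in> L \<and> S = h ` cball v (norm l / 32) \<and>
    (\<forall>w \<in> cball v (norm l / 32). norm (h w - base) \<le> norm base / 32 \<and> orbit L (h w) (l / 2) (Suc n) = w) \<and>
    (\<forall>w \<in> cball v (norm l / 32). \<forall>w' \<in> cball v (norm l / 32).
      contraction K n * norm (w - w') \<le> norm (h w - h w') \<and> norm (h w - h w') \<le> 1 / norm crit * norm (w - w')) \<and>
    (\<forall>\<beta> \<in> S. \<forall>n'. n = Suc n' \<longrightarrow> orbit L \<beta> (l / 2) n \<notin> L \<and>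
      norm base / (2 * scale) * real (K + n') \<le> norm (orbit L \<beta> (l / 2) (Suc n))))"

section \<open>The tree of parameter pieces\<close>

lemma crit_nonzero: "crit \<noteq> 0"
  unfolding crit_def by (rule wp_half_nonzero)

lemma base_nonzero: "base \<noteq> 0"
  using crit_nonzero l_nonzero by (simp add: base_def)

lemma scale_pos: "0 < scale"
  using crit_nonzero by (simp add: scale_def)

lemma radius_square: "radius k^2 = scale / real k"
  using scale_pos by (simp add: radius_def)

lemma radius_pos: "1 \<le> k \<Longrightarrow> 0 < radius k"
  using scale_pos by (simp add: radius_def)

lemma expansion_pos: "1 \<le> k \<Longrightarrow> 0 < expansion k"
  using radius_pos base_nonzero by (simp add: expansion_def)

lemma contraction_pos: "1 \<le> K \<Longrightarrow> 0 < contraction K n"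
  using crit_nonzero expansion_pos unfolding contraction_def
  by (intro mult_pos_pos prod_pos) auto

lemma expansion_radius:
  assumes "1 \<le> k"
  shows "3/4 * expansion k * (radius k / 100) = 4 * norm l * real k"
proof -
  have r: "radius k \<noteq> 0" using radius_pos[OF assms] by simp
  have "3/4 * expansion k * (radius k / 100) = 3/200 * norm base / radius k^2"
    using r by (simp add: expansion_def power2_eq_square power3_eq_cube)
  also have "\<dots> = 4 * norm l * real k"
    unfolding radius_square scale_def base_def using crit_nonzero assms
    by (simp add: norm_divide field_simps)
  finally show ?thesis .
qed

lemma inverse_expansion:
  assumes "1 \<le> k"
  shows "4/5 / expansion k = 2/5 / norm base * scale powr (3/2) * real k powr (-3/2)"
proof -
  have "radius k = (scale / real k) powr (1/2)"
    using scale_pos by (simp add: radius_def powr_half_sqrt)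
  then have "radius k^3 = (scale / real k) powr (3/2)"
    using scale_pos assms by (simp add: powr_powr flip: powr_numeral)
  also have "\<dots> = scale powr (3/2) * real k powr (-3/2)"
  proof -
    have "real k powr (-3/2) = inverse (real k powr (3/2))" using powr_minus[of "real k" "3/2"] by simp
    moreover have "(scale / real k) powr (3/2) = scale powr (3/2) / real k powr (3/2)" by (rule powr_divide)
    ultimately show ?thesis by (simp only: divide_inverse)
  qed
  finally show ?thesis using radius_pos[OF assms] by (simp add: expansion_def)
qed

lemma eventually_admissible: "\<forall>\<^sub>F k in sequentially. admissible k"
proof -
  have "(\<lambda>k. sqrt (scale / real k)) \<longlonglongrightarrow> sqrt 0"
    by (intro tendsto_real_sqrt lim_const_over_n)
  then have r: "radius \<longlonglongrightarrow> 0" by (simp add: radius_def[abs_def])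
  have r3: "(\<lambda>k. c * radius k^3) \<longlonglongrightarrow> c * 0^3" for c
    by (intro tendsto_intros r)
  have "\<forall>\<^sub>F k in sequentially. radius k < norm l / 64"
    using r l_nonzero by (intro order_tendstoD) auto
  moreover have "\<forall>\<^sub>F k in sequentially. wp_lip * radius k^3 < 1/16"
    using r3[of wp_lip] by (intro order_tendstoD) auto
  moreover have "\<forall>\<^sub>F k in sequentially. 4/3 * radius k^3 < 2 * norm base"
    using order_tendstoD(2)[OF r3[of "4/3"], of "2 * norm base"] base_nonzero by simp
  ultimately show ?thesis
    using eventually_ge_at_top[of 2]
  proof eventually_elim
    case (elim k)
    have "0 < radius k" using elim by (intro radius_pos) auto
    then have "4/3 \<le> expansion k" using elim by (simp add: expansion_def field_simps)
    then show ?case using elim by (simp add: admissible_def)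
  qed
qed

text \<open>The first image of \<open>l / 2\<close> is \<open>crit\<close> times the parameter, so
  the parametrisation is division by \<open>crit\<close> and both Lipschitz constants equal
  \<open>1 / norm crit\<close>.\<close>

lemma node_root: "node K 0 ((\<lambda>w. w / crit) ` cball l (norm l / 32))"
  unfolding node_def
proof (intro exI conjI ballI allI impI)
  show "l \<in> L" by simp
  fix w assume w: "w \<in> cball l (norm l / 32)"
  have "norm (w / crit - base) = norm (w - l) / norm crit"
    by (simp add: base_def norm_divide flip: diff_divide_distrib)
  also have "\<dots> \<le> norm l / 32 / norm crit"
    using w by (intro divide_right_mono) (auto simp: dist_norm norm_minus_commute)
  finally show "norm (w / crit - base) \<le> norm base / 32" by (simp add: base_def norm_divide)
  show "orbit L (w / crit) (l / 2) (Suc 0) = w" using crit_nonzero by (simp add: crit_def)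
  show "contraction K 0 * norm (w - w') \<le> norm (w / crit - w' / crit)"
    "norm (w / crit - w' / crit) \<le> 1 / norm crit * norm (w - w')" for w'
    by (simp_all add: contraction_def norm_divide flip: diff_divide_distrib)
qed auto

lemma node_compact:
  assumes "node K n S"
  shows "compact S \<and> S \<noteq> {}"
proof -
  obtain v :: complex and h :: "complex \<Rightarrow> complex" where S: "S = h ` cball v (norm l / 32)"
    and h: "\<And>w w'. w \<in> cball v (norm l / 32) \<Longrightarrow> w' \<in> cball v (norm l / 32) \<Longrightarrow>
      norm (h w - h w') \<le> 1 / norm crit * norm (w - w')"
    using assms unfolding node_def by blast
  have "(1 / norm crit)-lipschitz_on (cball v (norm l / 32)) h"
    by (rule lipschitz_onI) (use h in \<open>auto simp: dist_norm\<close>)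
  then have "continuous_on (cball v (norm l / 32)) h" by (rule lipschitz_on_continuous_on)
  then show ?thesis unfolding S by (auto intro: compact_continuous_image)
qed

text \<open>The case \<open>k = K + n\<close>, \<open>M = 1 / norm crit\<close> of
  \<open>inverse_branches\<close>. As \<open>base = l / crit\<close>, the smallness of
  \<open>M * radius\<close> becomes a bound on \<open>radius\<close> by \<open>norm l / 32\<close>,
  the same on all levels. The lower Lipschitz bound carries the separation of grid indices over to
  parameters.\<close>

lemma node_step:
  assumes node: "node K n S" and adm: "admissible (K + n)" and K: "1 \<le> K"
  shows "\<exists>ch. \<forall>p \<in> {..<K + n} \<times> {..<K + n}. node K (Suc n) (ch p) \<and> ch p \<subseteq> S \<and>
    (\<forall>q \<in> {..<K + n} \<times> {..<K + n}. \<forall>x \<in> ch p. \<forall>y \<in> ch q.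
      \<bar>real (fst p) - real (fst q)\<bar> \<le> 1/2 + dist x y / (contraction K (Suc n) * norm l / 2) \<and>
      \<bar>real (snd p) - real (snd q)\<bar> \<le> 1/2 + dist x y / (contraction K (Suc n) * norm l / 2))"
proof -
  let ?e = "norm l / 32" and ?G = "{..<K + n} \<times> {..<K + n}"
  obtain v h where v: "v \<in> L" and S: "S = h ` cball v ?e"
    and h1: "\<And>w. w \<in> cball v ?e \<Longrightarrow> norm (h w - base) \<le> norm base / 32 \<and> orbit L (h w) (l / 2) (Suc n) = w"
    and h2: "\<And>w w'. w \<in> cball v ?e \<Longrightarrow> w' \<in> cball v ?e \<Longrightarrow>
      contraction K n * norm (w - w') \<le> norm (h w - h w') \<and> norm (h w - h w') \<le> 1 / norm crit * norm (w - w')"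
    using node unfolding node_def by blast
  have k: "1 \<le> K + n" using K by simp
  have cn: "contraction K (Suc n) = contraction K n * (4/5 / expansion (K + n))"
    by (simp add: contraction_def)
  have cpos: "0 < contraction K n" "0 < contraction K (Suc n)" using contraction_pos[OF K] by auto
  have adm_k: "radius (K + n) \<le> norm l / 64" "wp_lip * radius (K + n)^3 \<le> 1/16" "4/3 \<le> expansion (K + n)"
    using adm by (auto simp: admissible_def)
  have M_nonneg: "0 \<le> 1 / norm crit" by simp
  have nl: "0 < norm l" using l_nonzero by simp
  have M_radius: "1 / norm crit * radius (K + n) \<le> norm base / 32"
  proof -
    have "radius (K + n) \<le> norm l / 32" using adm nl unfolding admissible_def by linarith
    then have "radius (K + n) / norm crit \<le> (norm l / 32) / norm crit" by (rule divide_right_mono) simp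
    then show ?thesis by (simp add: base_def norm_divide)
  qed
  note branches = inverse_branches[where h = h, OF v radius_pos[OF k] adm_k(1,2) M_radius base_nonzero M_nonneg less_imp_le[OF cpos(1)]
      _ _ _ expansion_def adm_k(3) k expansion_radius[OF k]]
  obtain g lam where lam: "\<And>p. lam p \<in> L"
    and g1: "\<And>p w. p \<in> ?G \<Longrightarrow> w \<in> cball (lam p) ?e \<Longrightarrow>
      g w \<in> cball v ?e \<and> g w \<notin> L \<and> h (g w) * wp L (g w) = w \<and> norm base / (2 * radius (K + n)^2) \<le> norm w"
    and g2: "\<And>p q w w'. \<lbrakk>p \<in> ?G; q \<in> ?G; w \<in> cball (lam p) ?e; w' \<in> cball (lam q) ?e\<rbrakk>
      \<Longrightarrow> contraction K n * (4/5 / expansion (K + n)) * norm (w - w') \<le> norm (h (g w) - h (g w')) \<and>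
        norm (h (g w) - h (g w')) \<le> 1 / norm crit * norm (w - w')"
    and g3: "\<And>p q w w'. \<lbrakk>w \<in> cball (lam p) ?e; w' \<in> cball (lam q) ?e\<rbrakk>
      \<Longrightarrow> \<bar>real (fst p) - real (fst q)\<bar> \<le> 1/2 + 2 * norm (w - w') / norm l \<and>
          \<bar>real (snd p) - real (snd q)\<bar> \<le> 1/2 + 2 * norm (w - w') / norm l"
  proof (rule branches, goal_cases)
    case (1 w)
    then show ?case using h1 by blast
  next
    case (2 w w')
    then show ?case using h2 by blast
  next
    case (3 w w')
    then show ?case using h2 by blast
  next
    case (4 g lam)
    show ?case by (rule that) (fact 4)+
  qed
  define ch where "ch p = (\<lambda>w. h (g w)) ` cball (lam p) ?e" for p
  have orb: "orbit L (h (g w)) (l / 2) (Suc n) = g w" "orbit L (h (g w)) (l / 2) (Suc (Suc n)) = w"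
    if "p \<in> ?G" "w \<in> cball (lam p) ?e" for p w
  proof -
    show 1: "orbit L (h (g w)) (l / 2) (Suc n) = g w" using h1 g1[OF that] by blast
    have "orbit L (h (g w)) (l / 2) (Suc (Suc n)) = h (g w) * wp L (orbit L (h (g w)) (l / 2) (Suc n))"
      by (rule orbit.simps(2))
    then show "orbit L (h (g w)) (l / 2) (Suc (Suc n)) = w" unfolding 1 using g1[OF that] by simp
  qed
  have rr: "norm base / (2 * radius (K + n)^2) = norm base / (2 * scale) * real (K + n)"
    unfolding radius_square by simp
  have nodes: "node K (Suc n) (ch p)" if p: "p \<in> ?G" for p
    unfolding node_def
  proof (intro exI[of _ "lam p"] exI[of _ "\<lambda>w. h (g w)"] conjI ballI allI impI)
    show "lam p \<in> L" by (rule lam)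
    show "ch p = (\<lambda>w. h (g w)) ` cball (lam p) ?e" by (simp add: ch_def)
    show "norm (h (g w) - base) \<le> norm base / 32" if "w \<in> cball (lam p) ?e" for w
      using h1 g1[OF p that] by blast
    show "orbit L (h (g w)) (l / 2) (Suc (Suc n)) = w" if "w \<in> cball (lam p) ?e" for w
      by (rule orb[OF p that])
    show "contraction K (Suc n) * norm (w - w') \<le> norm (h (g w) - h (g w'))"
      "norm (h (g w) - h (g w')) \<le> 1 / norm crit * norm (w - w')"
      if "w \<in> cball (lam p) ?e" "w' \<in> cball (lam p) ?e" for w w'
      using g2[OF p p that] unfolding cn by auto
    fix \<beta> n' assume \<beta>: "\<beta> \<in> ch p" "Suc n = Suc n'"
    then obtain w where w: "w \<in> cball (lam p) ?e" "\<beta> = h (g w)" by (auto simp: ch_def)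
    show "orbit L \<beta> (l / 2) (Suc n) \<notin> L"
      unfolding w(2) orb(1)[OF p w(1)] using g1[OF p w(1)] by blast
    show "norm base / (2 * scale) * real (K + n') \<le> norm (orbit L \<beta> (l / 2) (Suc (Suc n)))"
      unfolding w(2) orb(2)[OF p w(1)] using g1[OF p w(1)] rr \<beta>(2) by simp
  qed
  have sub: "ch p \<subseteq> S" if "p \<in> ?G" for p
    using g1[OF that] by (auto simp: ch_def S)
  have sep: "\<bar>real (fst p) - real (fst q)\<bar> \<le> 1/2 + dist x y / (contraction K (Suc n) * norm l / 2) \<and>
      \<bar>real (snd p) - real (snd q)\<bar> \<le> 1/2 + dist x y / (contraction K (Suc n) * norm l / 2)"
    if pq: "p \<in> ?G" "q \<in> ?G" and xy: "x \<in> ch p" "y \<in> ch q" for p q x y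
  proof -
    obtain w where w: "w \<in> cball (lam p) ?e" "x = h (g w)" using xy by (auto simp: ch_def)
    obtain w' where w': "w' \<in> cball (lam q) ?e" "y = h (g w')" using xy by (auto simp: ch_def)
    have "contraction K (Suc n) * norm (w - w') \<le> dist x y"
      using g2[OF pq w(1) w'(1)] unfolding cn w(2) w'(2) dist_norm by blast
    then have "norm (w - w') \<le> dist x y / contraction K (Suc n)"
      using cpos(2) by (simp add: pos_le_divide_eq mult.commute)
    then have "2 / norm l * norm (w - w') \<le> 2 / norm l * (dist x y / contraction K (Suc n))"
      by (intro mult_left_mono) auto
    then have "2 * norm (w - w') / norm l \<le> dist x y / (contraction K (Suc n) * norm l / 2)"
      by (simp add: mult.commute)
    then show ?thesis using g3[OF w(1) w'(1)] by linarith
  qed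
  show ?thesis
    by (rule exI[of _ ch]) (use nodes sub sep in blast)
qed

lemma node_limit:
  assumes node: "\<And>n. node K n (S n)" and x: "\<And>n. x \<in> S n"
  shows "x \<noteq> 0 \<and> escapes L x (l / 2)"
proof -
  obtain v :: complex and h :: "complex \<Rightarrow> complex" where S: "S 0 = h ` cball v (norm l / 32)"
    and h: "\<And>w. w \<in> cball v (norm l / 32) \<Longrightarrow> norm (h w - base) \<le> norm base / 32"
    using node[of 0] unfolding node_def by blast
  have "norm (x - base) \<le> norm base / 32" using x[of 0] h unfolding S by blast
  moreover have "norm base / 32 < norm base" using base_nonzero by simp
  ultimately have "x \<noteq> 0" by auto
  have orb: "orbit L x (l / 2) (Suc n) \<notin> L \<and>
      norm base / (2 * scale) * real (K + n) \<le> norm (orbit L x (l / 2) (Suc (Suc n)))" for n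
    using node[of "Suc n"] x[of "Suc n"] unfolding node_def by blast
  \<comment> \<open>Level \<open>Suc n\<close> controls the iterate of order \<open>Suc n\<close>;
    order 0 is the half period itself.\<close>
  have notL: "orbit L x (l / 2) n \<notin> L" for n
    using orb half_l_notin_L by (cases n) auto
  define a where "a = norm base / (2 * scale)"
  have a: "0 < a" using base_nonzero scale_pos by (simp add: a_def)
  have lim: "filterlim (\<lambda>n. a * real n) at_top sequentially"
    by (rule filterlim_tendsto_pos_mult_at_top[OF tendsto_const a filterlim_real_sequentially])
  have le: "a * real n \<le> norm (orbit L x (l / 2) (Suc (Suc n)))" for n
  proof -
    have "a * real n \<le> a * real (K + n)" using a by (intro mult_left_mono) auto
    then show ?thesis using orb[of n] unfolding a_def by linarith
  qed
  have "filterlim (\<lambda>n. norm (orbit L x (l / 2) (Suc (Suc n)))) at_top sequentially"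
    by (rule filterlim_at_top_mono[OF lim always_eventually[OF allI[OF le]]])
  then have "filterlim (\<lambda>n. orbit L x (l / 2) (Suc (Suc n))) at_infinity sequentially"
    by (simp only: filterlim_norm_at_top_imp_at_infinity)
  then have "filterlim (orbit L x (l / 2)) at_infinity sequentially"
    using filterlim_sequentially_Suc[of "orbit L x (l / 2)" at_infinity]
      filterlim_sequentially_Suc[of "\<lambda>n. orbit L x (l / 2) (Suc n)" at_infinity] by blast
  then show ?thesis using \<open>x \<noteq> 0\<close> notL by (auto simp: escapes_def)
qed

section \<open>Mass against size, and the resulting cover bound\<close>

text \<open>Provides the hypothesis \<open>cond\<close> of the covering theorem. With
  \<open>k = K + n\<close>, one level multiplies the mass by \<open>k^(-2)\<close> and the side of
  the grid by \<open>b * (k + 1) powr (-1/2) / k\<close>; comparing the first with the power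
  \<open>t\<close> of the second gives exactly \<open>big\<close>. The constant \<open>C\<close>
  makes level 0 an equality.\<close>

lemma level_size_bound:
  fixes t :: real
  assumes t: "0 < t" and K: "2 \<le> K"
    and big: "\<And>k. K \<le> k \<Longrightarrow> (real k + 1) powr (t/2) * real k powr (t - 2)
      \<le> (2/5 / norm base * scale powr (3/2)) powr t"
  obtains C where "0 < C"
    "\<And>n. (\<Prod>i<n. 1 / (real (K + i))^2) \<le> C * (real (K + n) * (contraction K (Suc n) * norm l / 2) / 4) powr t"
proof -
  define s where "s n = contraction K (Suc n) * norm l / 2" for n
  define b where "b = 2/5 / norm base * scale powr (3/2)"
  have b: "0 < b" using base_nonzero scale_pos by (simp add: b_def)
  have s0: "0 < s n" for n using contraction_pos[of K "Suc n"] K l_nonzero by (simp add: s_def)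
  have sS: "s (Suc n) = s n * (b * real (K + n + 1) powr (-3/2))" for n
  proof -
    have "contraction K (Suc (Suc n)) = contraction K (Suc n) * (4/5 / expansion (K + Suc n))"
      by (simp only: contraction_def prod.lessThan_Suc mult.assoc)
    also have "4/5 / expansion (K + Suc n) = b * real (K + n + 1) powr (-3/2)"
      using inverse_expansion[of "K + Suc n"] by (simp add: b_def)
    finally show ?thesis by (simp add: s_def)
  qed
  define C where "C = 1 / (real K * s 0 / 4) powr t"
  have C: "0 < C" using s0[of 0] K by (simp add: C_def)
  have "(\<Prod>i<n. 1 / (real (K + i))^2) \<le> C * (real (K + n) * s n / 4) powr t" for n
  proof (induction n)
    case 0
    then show ?case using s0[of 0] K by (simp add: C_def)
  next
    case (Suc n)
    define k where "k = real (K + n)"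
    have k: "1 \<le> k" using K by (simp add: k_def)
    have kt: "k powr (t - 2) = k powr t / k^2" using k by (simp add: powr_diff powr_numeral)
    have "k powr t / k^2 * (k + 1) powr (t/2) \<le> b powr t"
      using big[of "K + n"] unfolding b_def k_def[symmetric] kt by (simp add: mult.commute)
    then have "k powr t / k^2 \<le> b powr t / (k + 1) powr (t/2)"
      using k by (simp add: pos_le_divide_eq)
    also have "\<dots> = (b * (k + 1) powr (-1/2)) powr t"
    proof -
      have "((k + 1) powr (-1/2)) powr t = (k + 1) powr (- (t/2))" by (simp add: powr_powr)
      also have "\<dots> = inverse ((k + 1) powr (t/2))" by (rule powr_minus)
      finally show ?thesis by (simp only: powr_mult divide_inverse)
    qed
    also have "(k + 1) powr (-1/2) = (k + 1) * (k + 1) powr (-3/2)"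
      using k by (simp add: powr_mult_base)
    finally have key: "k powr t / k^2 \<le> ((k + 1) * (b * (k + 1) powr (-3/2))) powr t"
      by (simp add: mult_ac)
    have "(\<Prod>i<Suc n. 1 / (real (K + i))^2) = (\<Prod>i<n. 1 / (real (K + i))^2) * (1 / k^2)"
      by (simp add: k_def)
    also have "\<dots> \<le> C * (k * s n / 4) powr t * (1 / k^2)"
      using Suc unfolding k_def by (intro mult_right_mono) auto
    also have "\<dots> = C * (s n / 4) powr t * (k powr t / k^2)"
      using k s0[of n] powr_mult[of k "s n / 4" t] by simp
    also have "\<dots> \<le> C * (s n / 4) powr t * ((k + 1) * (b * (k + 1) powr (-3/2))) powr t"
      using C by (intro mult_left_mono key) auto
    also have "\<dots> = C * (s n / 4 * ((k + 1) * (b * (k + 1) powr (-3/2)))) powr t"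
      unfolding mult.assoc[of C] powr_mult[of "s n / 4"] ..
    also have "s n / 4 * ((k + 1) * (b * (k + 1) powr (-3/2))) = real (K + Suc n) * s (Suc n) / 4"
      unfolding sS by (simp add: k_def add_ac mult_ac)
    finally show ?case .
  qed
  then show ?thesis using that C unfolding s_def by blast
qed

text \<open>The start \<open>K\<close>, and with it the tree and \<open>C\<close>, depends on
  \<open>t\<close>: all inequalities must hold from the root on. This is harmless because the
  dimension bound treats each exponent separately.\<close>

theorem escaping_cover_bound:
  assumes t: "0 < t" "t < 4/3"
  shows "\<exists>C>0. \<forall>U r. radius_cover t {\<beta>. \<beta> \<noteq> 0 \<and> escapes L \<beta> (l / 2)} U r \<longrightarrow>
    1 \<le> C * (\<Sum>i. r i powr t)"
proof -
  have "0 < (2/5 / norm base * scale powr (3/2)) powr t" using base_nonzero scale_pos by simp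
  from eventually_conj[OF eventually_admissible eventually_powr_bound[OF t this]]
  obtain K where K: "\<And>k. K \<le> k \<Longrightarrow> admissible k"
    "\<And>k. K \<le> k \<Longrightarrow> (real k + 1) powr (t/2) * real k powr (t - 2) \<le> (2/5 / norm base * scale powr (3/2)) powr t"
    unfolding eventually_sequentially by blast
  have K2: "2 \<le> K" using K(1)[of K] by (simp add: admissible_def)
  obtain C where C: "0 < C"
    "\<And>n. (\<Prod>i<n. 1 / (real (K + i))^2) \<le> C * (real (K + n) * (contraction K (Suc n) * norm l / 2) / 4) powr t"
    using level_size_bound[OF t(1) K2 K(2)] by blast
  show ?thesis
  proof (intro exI[of _ C] conjI allI impI)
    fix U r assume U: "radius_cover t {\<beta>. \<beta> \<noteq> 0 \<and> escapes L \<beta> (l / 2)} U r"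
    show "1 \<le> C * (\<Sum>i. r i powr t)"
    proof (rule cantor_scheme_cover_bound[of "node K" _ "\<lambda>n. K + n" "\<lambda>n. contraction K (Suc n) * norm l / 2"])
      show "node K 0 ((\<lambda>w. w / crit) ` cball l (norm l / 32))" by (rule node_root)
      show "compact S \<and> S \<noteq> {}" if "node K n S" for n S by (rule node_compact[OF that])
      show "\<exists>ch. \<forall>p \<in> {..<K + n} \<times> {..<K + n}. node K (Suc n) (ch p) \<and> ch p \<subseteq> S \<and>
        (\<forall>q \<in> {..<K + n} \<times> {..<K + n}. \<forall>x \<in> ch p. \<forall>y \<in> ch q.
          \<bar>real (fst p) - real (fst q)\<bar> \<le> 1/2 + dist x y / (contraction K (Suc n) * norm l / 2) \<and>
          \<bar>real (snd p) - real (snd q)\<bar> \<le> 1/2 + dist x y / (contraction K (Suc n) * norm l / 2))"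
        if "node K n S" for n S
        by (rule node_step[OF that K(1)]) (use K2 in auto)
      show "x \<in> {\<beta>. \<beta> \<noteq> 0 \<and> escapes L \<beta> (l / 2)}"
        if "\<And>n. node K n (S n)" "\<And>n. x \<in> S n" for S x
        using node_limit[OF that] by simp
      show "0 < contraction K (Suc n) * norm l / 2" for n
        using contraction_pos[of K "Suc n"] K2 l_nonzero by simp
    qed (use U C K2 t in \<open>auto simp: radius_cover_def\<close>)
  qed (rule C(1))
qed

section \<open>Symmetry between the three critical orbits\<close>

lemma orbit_om: "orbit L \<beta> (om * c) n = om * orbit L \<beta> c n"
  by (induction n) (simp_all add: wp_om)

lemma escapes_om:
  assumes "escapes L \<beta> c"
  shows "escapes L \<beta> (om * c)"
proof -
  have "filterlim (\<lambda>n. om * orbit L \<beta> c n) at_infinity sequentially"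
    using assms unfolding escapes_def
    by (intro tendsto_mult_filterlim_at_infinity[OF tendsto_const]) auto
  moreover have "orbit L \<beta> (om * c) = (\<lambda>n. om * orbit L \<beta> c n)" by (rule ext) (rule orbit_om)
  ultimately show ?thesis using assms by (simp add: escapes_def)
qed

lemma orbit_uminus: "orbit L \<beta> (- c) (Suc n) = orbit L \<beta> c (Suc n)"
proof (induction n)
  case (Suc n)
  then show ?case by (metis orbit.simps(2))
qed (simp add: wp_uminus)

lemma escapes_uminus:
  assumes "escapes L \<beta> c"
  shows "escapes L \<beta> (- c)"
proof -
  have "orbit L \<beta> (- c) n \<notin> L" for n
  proof (cases n)
    case 0
    then show ?thesis using assms spec[of "\<lambda>n. orbit L \<beta> c n \<notin> L" 0] by (simp add: escapes_def)
  next
    case (Suc m)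
    then show ?thesis using assms unfolding Suc orbit_uminus escapes_def by blast
  qed
  moreover have "filterlim (\<lambda>n. orbit L \<beta> c (Suc n)) at_infinity sequentially"
    using assms filterlim_sequentially_Suc[of "orbit L \<beta> c" at_infinity] unfolding escapes_def by blast
  then have "filterlim (\<lambda>n. orbit L \<beta> (- c) (Suc n)) at_infinity sequentially"
    by (simp only: orbit_uminus)
  then have "filterlim (orbit L \<beta> (- c)) at_infinity sequentially"
    using filterlim_sequentially_Suc[of "orbit L \<beta> (- c)" at_infinity] by blast
  ultimately show ?thesis by (simp add: escapes_def)
qed

text \<open>By \<open>1 + om = - om^2\<close> the third half period is
  \<open>- om^2 * l / 2\<close>, so rotations and the sign change carry \<open>l / 2\<close> to both
  others.\<close>

lemma escapes_half_periods:
  assumes "escapes L \<beta> (l / 2)"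
  shows "escapes L \<beta> (om * l / 2)" "escapes L \<beta> ((l + om * l) / 2)"
proof -
  show 1: "escapes L \<beta> (om * l / 2)" using escapes_om[OF assms] by simp
  have e: "- (om * (om * l / 2)) = (l + om * l) / 2"
  proof -
    have "- (om * (om * l / 2)) = - (om^2) * l / 2" by (simp add: power2_eq_square)
    also have "- (om^2) = 1 + om" by (simp add: om_square)
    finally show ?thesis by (simp add: distrib_right)
  qed
  show "escapes L \<beta> ((l + om * l) / 2)"
    using escapes_uminus[OF escapes_om[OF 1]] unfolding e .
qed

end

theorem mainTheorem1:
  fixes l1 :: complex
  defines "l2 \<equiv> cis (2 * pi / 3) * l1"
  defines "L \<equiv> lattice l1 l2"
  assumes "l1 \<noteq> 0"
    and "\<forall>c \<in> {l1 / 2, l2 / 2, (l1 + l2) / 2}. wp L c \<in> L"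
  shows "hausdorff_dim {beta. beta \<noteq> 0 \<and>
            (\<forall>c \<in> {l1 / 2, l2 / 2, (l1 + l2) / 2}. escapes L beta c)} \<ge> 4 / 3"
proof -
  interpret T: triangular_lattice l1 by standard fact
  have l2: "l2 = om * l1" by (simp add: l2_def om_def)
  have L: "L = T.L" by (simp add: L_def T.L_def l2)
  have "{beta. beta \<noteq> 0 \<and> (\<forall>c \<in> {l1 / 2, l2 / 2, (l1 + l2) / 2}. escapes L beta c)}
      = {\<beta>. \<beta> \<noteq> 0 \<and> escapes T.L \<beta> (l1 / 2)}"
    unfolding L l2 using T.escapes_half_periods by auto
  moreover have "4/3 \<le> hausdorff_dim {\<beta>. \<beta> \<noteq> 0 \<and> escapes T.L \<beta> (l1 / 2)}"
    by (rule hausdorff_dim_ge) (simp, rule T.escaping_cover_bound, auto)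
  ultimately show ?thesis by simp
qed

end
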